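(* Let $A$ and $B$ be Hopf algebras over $\mathbb C$ with invertible antipodes and $\varphi$ a generalized Hopf pairing between them. With the diagonal action of the quantum double $D_\varphi(A,B)$ on the Heisenberg double $H_\varphi(A,B)$ given, for $a,a'\in A$ and $b,b'\in B$, by $$(a\otimes b).(b'\sharp a')=\sum (a_{(1)}\otimes b_{(1)}).b'\ \sharp\ (a_{(2)}\otimes b_{(2)}).a',$$ $H_\varphi(A,B)$ is a $D_\varphi(A,B)$-module algebra.
   Context: Tensor products are over $\mathbb C$; Sweedler notation is used. A generalized Hopf pairing between $A$ and $B$ is a bilinear form $\varphi:A\times B\to\mathbb C$ such that for all $a,a'\in A$, $b,b'\in B$: $\varphi(a,bb')=\sum\varphi(a_{(1)},b)\varphi(a_{(2)},b')$; $\varphi(aa',b)=\sum\varphi(a,b_{(2)})\varphi(a',b_{(1)})$; $\varphi(a,1)=\varepsilon(a)$, $\varphi(1,b)=\varepsilon(b)$. The quantum double $D_\varphi(A,B)$ is the vector space $A\otimes B$ with the tensor product coalgebra structure and multiplication $(a\otimes b)(a'\otimes b')=\sum\varphi(S^{-1}(a'_{(1)}),b_{(1)})\varphi(a'_{(3)},b_{(3)})\,aa'_{(2)}\otimes b_{(2)}b'$. The Heisenberg double $H_\varphi(A,B)$ is the vector space $B\otimes A$ (pure tensors written $b\sharp a$) with product $(b\sharp a)(b'\sharp a')=\sum\varphi(a_{(1)},b'_{(1)})\,bb'_{(2)}\sharp a_{(2)}a'$. Schrödinger representations: $D_\varphi(A,B)$ acts on $A$ by $(a\otimes1).x=\sum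 a_{(1)}xS(a_{(2)})$, $(1\otimes b).x=\sum\varphi(x_{(1)},S(b))x_{(2)}$, and on $B$ by $(a\otimes1).y=\sum\varphi(a,y_{(1)})y_{(2)}$, $(1\otimes b).y=\sum b_{(1)}yS(b_{(2)})$, for $a,x\in A$, $b,y\in B$, where $a\otimes b=(a\otimes1)(1\otimes b)$. *)

theory Defs
  imports Complex_Main "HOL-Library.Poly_Mapping"
begin

section \<open>Complex vector spaces\<close>

class complex_vector = ab_group_add +
  fixes scaleC :: "complex \<Rightarrow> 'a \<Rightarrow> 'a" (infixr "*\<^sub>C" 75)
  assumes scaleC_add_right: "c *\<^sub>C (x + y) = c *\<^sub>C x + c *\<^sub>C y"
    and scaleC_add_left: "(c + d) *\<^sub>C x = c *\<^sub>C x + d *\<^sub>C x"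
    and scaleC_scaleC: "c *\<^sub>C d *\<^sub>C x = (c * d) *\<^sub>C x"
    and scaleC_one: "1 *\<^sub>C x = x"

instantiation complex :: complex_vector
begin

definition scaleC_complex :: "complex \<Rightarrow> complex \<Rightarrow> complex"
  where "scaleC_complex c x = c * x"

instance
  by standard (simp_all add: scaleC_complex_def algebra_simps)

end

interpretation complex_vector: vector_space "scaleC :: complex \<Rightarrow> 'a \<Rightarrow> 'a :: complex_vector"
  by unfold_locales (simp_all add: scaleC_add_right scaleC_add_left scaleC_scaleC scaleC_one)

abbreviation clinear :: "('a :: complex_vector \<Rightarrow> 'b :: complex_vector) \<Rightarrow> bool"
  where "clinear \<equiv> Vector_Spaces.linear scaleC scaleC"

lemma clinear_iff:
  fixes f :: "'a :: complex_vector \<Rightarrow> 'b :: complex_vector"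
  shows "clinear f \<longleftrightarrow> (\<forall>x y. f (x + y) = f x + f y) \<and> (\<forall>c x. f (c *\<^sub>C x) = c *\<^sub>C f x)"
  by (simp add: Vector_Spaces.linear_iff complex_vector.vector_space_axioms)

definition cbilinear :: "('a :: complex_vector \<Rightarrow> 'b :: complex_vector \<Rightarrow> 'c :: complex_vector) \<Rightarrow> bool"
  where "cbilinear f \<longleftrightarrow> (\<forall>x. clinear (f x)) \<and> (\<forall>y. clinear (\<lambda>x. f x y))"


section \<open>Tensor products over the complex numbers\<close>

text \<open>
  The tensor product is the free vector space on pairs modulo the subspace generated by
  the bilinearity relations.
\<close>

lift_definition fscale :: "complex \<Rightarrow> ('k \<Rightarrow>\<^sub>0 complex) \<Rightarrow> ('k \<Rightarrow>\<^sub>0 complex)"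
  is "\<lambda>c f k. c * f k"
  by (erule finite_subset[rotated]) auto

lemma lookup_fscale: "Poly_Mapping.lookup (fscale c p) k = c * Poly_Mapping.lookup p k"
  by (simp add: fscale.rep_eq)

interpretation free_space: vector_space "fscale :: complex \<Rightarrow> ('k \<Rightarrow>\<^sub>0 complex) \<Rightarrow> _"
  by unfold_locales
    (simp_all add: poly_mapping_eq_iff fun_eq_iff lookup_fscale lookup_add algebra_simps)

abbreviation basis_pair :: "'a \<Rightarrow> 'b \<Rightarrow> ('a \<times> 'b) \<Rightarrow>\<^sub>0 complex"
  where "basis_pair x y \<equiv> Poly_Mapping.single (x, y) 1"

definition tensor_relators :: "(('a :: complex_vector \<times> 'b :: complex_vector) \<Rightarrow>\<^sub>0 complex) set"
  where "tensor_relators =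
    {basis_pair (x + x') y - basis_pair x y - basis_pair x' y |x x' y. True} \<union>
    {basis_pair x (y + y') - basis_pair x y - basis_pair x y' |x y y'. True} \<union>
    {basis_pair (c *\<^sub>C x) y - fscale c (basis_pair x y) |c x y. True} \<union>
    {basis_pair x (c *\<^sub>C y) - fscale c (basis_pair x y) |c x y. True}"

definition tensor_eq ::
    "(('a :: complex_vector \<times> 'b :: complex_vector) \<Rightarrow>\<^sub>0 complex) \<Rightarrow> _ \<Rightarrow> bool"
  where "tensor_eq p q \<longleftrightarrow> p - q \<in> free_space.span tensor_relators"

lemma equivp_tensor_eq:
  "equivp (tensor_eq :: (('a :: complex_vector \<times> 'b :: complex_vector) \<Rightarrow>\<^sub>0 complex) \<Rightarrow> _)"
  (is "equivp ?R")
proof (rule equivpI)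
  show "reflp ?R"
    by (rule reflpI) (simp add: tensor_eq_def free_space.span_zero)
  show "symp ?R"
  proof (rule sympI)
    fix p q :: "('a \<times> 'b) \<Rightarrow>\<^sub>0 complex"
    assume "tensor_eq p q"
    then have "- (p - q) \<in> free_space.span tensor_relators"
      unfolding tensor_eq_def by (rule free_space.span_neg)
    then show "tensor_eq q p"
      by (simp add: tensor_eq_def)
  qed
  show "transp ?R"
  proof (rule transpI)
    fix p q r :: "('a \<times> 'b) \<Rightarrow>\<^sub>0 complex"
    assume "tensor_eq p q" "tensor_eq q r"
    then have "(p - q) + (q - r) \<in> free_space.span tensor_relators"
      unfolding tensor_eq_def by (rule free_space.span_add)
    then show "tensor_eq p r"
      by (simp add: tensor_eq_def)
  qed
qed

quotient_type (overloaded) ('a, 'b) tensor (infixr "\<otimes>" 70)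
  = "('a :: complex_vector \<times> 'b :: complex_vector) \<Rightarrow>\<^sub>0 complex" / tensor_eq
  by (rule equivp_tensor_eq)

instantiation tensor :: (complex_vector, complex_vector) complex_vector
begin

lift_definition zero_tensor :: "'a \<otimes> 'b" is 0 .

lift_definition plus_tensor :: "'a \<otimes> 'b \<Rightarrow> 'a \<otimes> 'b \<Rightarrow> 'a \<otimes> 'b" is "(+)"
  unfolding tensor_eq_def
  by (metis add_diff_add free_space.span_add)

lift_definition uminus_tensor :: "'a \<otimes> 'b \<Rightarrow> 'a \<otimes> 'b" is uminus
  unfolding tensor_eq_def
  by (metis free_space.span_neg minus_diff_minus)

lift_definition minus_tensor :: "'a \<otimes> 'b \<Rightarrow> 'a \<otimes> 'b \<Rightarrow> 'a \<otimes> 'b" is "(-)"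
proof -
  fix p p' q q' :: "('a \<times> 'b) \<Rightarrow>\<^sub>0 complex"
  assume "tensor_eq p p'" "tensor_eq q q'"
  then have "(p - p') - (q - q') \<in> free_space.span tensor_relators"
    unfolding tensor_eq_def by (rule free_space.span_diff)
  then show "tensor_eq (p - q) (p' - q')"
    by (simp add: tensor_eq_def algebra_simps)
qed

lift_definition scaleC_tensor :: "complex \<Rightarrow> 'a \<otimes> 'b \<Rightarrow> 'a \<otimes> 'b" is fscale
  unfolding tensor_eq_def
  by (metis free_space.span_scale free_space.scale_right_diff_distrib)

instance
proof
  fix x y z :: "'a \<otimes> 'b" and c d :: complex
  show "x + y + z = x + (y + z)" by transfer (simp add: tensor_eq_def free_space.span_zero add.assoc)
  show "x + y = y + x" by transfer (simp add: tensor_eq_def free_space.span_zero add.commute)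
  show "0 + x = x" by transfer (simp add: tensor_eq_def free_space.span_zero)
  show "- x + x = 0" by transfer (simp add: tensor_eq_def free_space.span_zero)
  show "x - y = x + - y" by transfer (simp add: tensor_eq_def free_space.span_zero)
  show "c *\<^sub>C (x + y) = c *\<^sub>C x + c *\<^sub>C y"
    by transfer (simp add: tensor_eq_def free_space.span_zero free_space.scale_right_distrib)
  show "(c + d) *\<^sub>C x = c *\<^sub>C x + d *\<^sub>C x"
    by transfer (simp add: tensor_eq_def free_space.span_zero free_space.scale_left_distrib)
  show "c *\<^sub>C d *\<^sub>C x = (c * d) *\<^sub>C x"
    by transfer (simp add: tensor_eq_def free_space.span_zero)
  show "1 *\<^sub>C x = x"
    by transfer (simp add: tensor_eq_def free_space.span_zero)
qed

end

lift_definition pure_tensor :: "'a :: complex_vector \<Rightarrow> 'b :: complex_vector \<Rightarrow> 'a \<otimes> 'b" (infixr "\<otimes>" 70)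
  is basis_pair .

lemma cbilinear_pure_tensor:
  "cbilinear (pure_tensor :: 'a :: complex_vector \<Rightarrow> 'b :: complex_vector \<Rightarrow> 'a \<otimes> 'b)"
proof -
  have rel: "tensor_eq p q" if "p - q \<in> tensor_relators" for p q :: "('a \<times> 'b) \<Rightarrow>\<^sub>0 complex"
    using that by (simp add: tensor_eq_def free_space.span_base)
  have "(x + x') \<otimes> y = x \<otimes> y + x' \<otimes> y" for x x' :: 'a and y :: 'b
    by transfer (rule rel, unfold tensor_relators_def diff_diff_eq[symmetric], blast)
  moreover have "x \<otimes> (y + y') = x \<otimes> y + x \<otimes> y'" for x :: 'a and y y' :: 'b
    by transfer (rule rel, unfold tensor_relators_def diff_diff_eq[symmetric], blast)
  moreover have "(c *\<^sub>C x) \<otimes> y = c *\<^sub>C (x \<otimes> y)" for c and x :: 'a and y :: 'b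
    by transfer (rule rel, unfold tensor_relators_def, blast)
  moreover have "x \<otimes> (c *\<^sub>C y) = c *\<^sub>C (x \<otimes> y)" for c and x :: 'a and y :: 'b
    by transfer (rule rel, unfold tensor_relators_def, blast)
  ultimately show ?thesis
    by (simp add: cbilinear_def clinear_iff)
qed

lemma basis_pair_induct [case_names zero basis add]:
  fixes p :: "('a \<times> 'b) \<Rightarrow>\<^sub>0 complex"
  assumes "P 0" "\<And>c x y. P (fscale c (basis_pair x y))" "\<And>p q. P p \<Longrightarrow> P q \<Longrightarrow> P (p + q)"
  shows "P p"
proof (induction p rule: update_induct)
  case const
  then show ?case by (rule assms(1))
next
  case (update f k c)
  have "Poly_Mapping.update k c f = f + fscale c (basis_pair (fst k) (snd k))"
    using update.hyps(1)
    by (intro poly_mapping_eqI)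
      (auto simp: lookup_update lookup_add lookup_fscale lookup_single when_def in_keys_iff)
  then show ?case
    using assms(2,3) update.IH by metis
qed

lemma tensor_induct [case_names zero pure add, induct type: tensor]:
  fixes t :: "'a :: complex_vector \<otimes> 'b :: complex_vector"
  assumes "P 0" "\<And>x y. P (x \<otimes> y)" "\<And>s t. P s \<Longrightarrow> P t \<Longrightarrow> P (s + t)"
  shows "P t"
proof (induction t rule: tensor.abs_induct)
  case (1 p)
  show ?case
  proof (induction p rule: basis_pair_induct)
    case zero
    then show ?case using assms(1) by (simp add: zero_tensor.abs_eq)
  next
    case (basis c x y)
    have "abs_tensor (fscale c (basis_pair x y)) = c *\<^sub>C (x \<otimes> y)"
      by (simp add: pure_tensor.abs_eq scaleC_tensor.abs_eq)
    also have "\<dots> = (c *\<^sub>C x) \<otimes> y"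
      using cbilinear_pure_tensor unfolding cbilinear_def clinear_iff by metis
    finally show ?case using assms(2) by simp
  next
    case (add p q)
    then show ?case using assms(3) by (simp flip: plus_tensor.abs_eq)
  qed
qed

text \<open>
  The linear map out of the tensor product induced by a bilinear map. It is meaningful only
  for bilinear arguments.
\<close>

definition tensor_lift ::
    "('a \<Rightarrow> 'b \<Rightarrow> 'c) \<Rightarrow> 'a :: complex_vector \<otimes> 'b :: complex_vector \<Rightarrow> 'c :: complex_vector"
  where "tensor_lift f = (THE g. clinear g \<and> (\<forall>x y. g (x \<otimes> y) = f x y))"

lemma tensor_universal:
  fixes f :: "'a :: complex_vector \<Rightarrow> 'b :: complex_vector \<Rightarrow> 'c :: complex_vector"
  assumes "cbilinear f"
  shows "\<exists>!g. clinear g \<and> (\<forall>x y. g (x \<otimes> y) = f x y)"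
proof (rule ex_ex1I)
  define F where "F p = (\<Sum>k\<in>Poly_Mapping.keys p. Poly_Mapping.lookup p k *\<^sub>C f (fst k) (snd k))" for p
  have F_eq: "F p = (\<Sum>k\<in>K. Poly_Mapping.lookup p k *\<^sub>C f (fst k) (snd k))"
    if "finite K" "Poly_Mapping.keys p \<subseteq> K" for p K
    unfolding F_def by (rule sum.mono_neutral_left) (use that in \<open>auto simp: in_keys_iff\<close>)
  have F_add: "F (p + q) = F p + F q" for p q
  proof -
    let ?K = "Poly_Mapping.keys p \<union> Poly_Mapping.keys q"
    show ?thesis
      using F_eq[of ?K p] F_eq[of ?K q] F_eq[of ?K "p + q"] Poly_Mapping.keys_add[of p q]
      by (simp add: lookup_add scaleC_add_left sum.distrib)
  qed
  have F_scale: "F (fscale c p) = c *\<^sub>C F p" for c p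
    using F_eq[of "Poly_Mapping.keys p" "fscale c p"]
    by (auto simp: F_def lookup_fscale in_keys_iff complex_vector.scale_sum_right subset_iff)
  have F_diff: "F (p - q) = F p - F q" for p q
    using F_add[of "p - q" q] by (simp add: algebra_simps)
  have F_basis: "F (basis_pair x y) = f x y" for x y
    by (simp add: F_def)
  have F_rel: "F r = 0" if "r \<in> tensor_relators" for r
    using that assms
    by (auto simp: tensor_relators_def F_diff F_basis F_scale cbilinear_def clinear_iff)
  have F_span: "F r = 0" if "r \<in> free_space.span tensor_relators" for r
    using that
  proof (induction rule: free_space.span_induct_alt)
    case base
    show ?case by (simp add: F_def)
  next
    case (step c r s)
    then show ?case by (simp add: F_add F_scale F_rel)
  qed
  have F_cong: "F p = F q" if "tensor_eq p q" for p q
    using F_span[of "p - q"] that by (simp add: F_diff tensor_eq_def)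
  define g where "g t = F (rep_tensor t)" for t
  have g_abs: "g (abs_tensor p) = F p" for p
    unfolding g_def
    by (rule F_cong) (rule Quotient3_rep_abs[OF Quotient3_tensor], simp add: equivp_reflp[OF equivp_tensor_eq])
  have "g (s + t) = g s + g t" for s t
    by (induction s rule: tensor.abs_induct, induction t rule: tensor.abs_induct)
      (simp add: plus_tensor.abs_eq g_abs F_add)
  moreover have "g (c *\<^sub>C t) = c *\<^sub>C g t" for c t
    by (induction t rule: tensor.abs_induct) (simp add: scaleC_tensor.abs_eq g_abs F_scale)
  ultimately show "\<exists>g. clinear g \<and> (\<forall>x y. g (x \<otimes> y) = f x y)"
    by (intro exI[of _ g]) (simp add: clinear_iff pure_tensor.abs_eq g_abs F_basis)
next
  fix g h :: "'a \<otimes> 'b \<Rightarrow> 'c"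
  assume g: "clinear g \<and> (\<forall>x y. g (x \<otimes> y) = f x y)" and h: "clinear h \<and> (\<forall>x y. h (x \<otimes> y) = f x y)"
  have zero: "k 0 = 0" if "clinear k" for k :: "'a \<otimes> 'b \<Rightarrow> 'c"
    using that unfolding clinear_iff by (metis add_cancel_right_right)
  have "g t = h t" for t
    by (induction t rule: tensor_induct) (use g h zero[of g] zero[of h] in \<open>auto simp: clinear_iff\<close>)
  then show "g = h" by blast
qed

lemma
  assumes "cbilinear f"
  shows clinear_tensor_lift: "clinear (tensor_lift f)"
    and tensor_lift_pure [simp]: "tensor_lift f (x \<otimes> y) = f x y"
  using theI'[OF tensor_universal[OF assms]] by (simp_all add: tensor_lift_def)

definition tensor_map ::
    "('a \<Rightarrow> 'c) \<Rightarrow> ('b \<Rightarrow> 'd) \<Rightarrow> 'a :: complex_vector \<otimes> 'b :: complex_vector \<Rightarrow>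
      'c :: complex_vector \<otimes> 'd :: complex_vector"
  where "tensor_map f g = tensor_lift (\<lambda>x y. f x \<otimes> g y)"

definition tensor_assoc ::
    "('a \<otimes> 'b) \<otimes> 'c \<Rightarrow> 'a :: complex_vector \<otimes> 'b :: complex_vector \<otimes> 'c :: complex_vector"
  where "tensor_assoc = tensor_lift (\<lambda>t z. tensor_lift (\<lambda>x y. x \<otimes> y \<otimes> z) t)"


section \<open>Algebras, bialgebras and Hopf algebras\<close>

record ('a :: complex_vector) alg =
  mult :: "'a \<Rightarrow> 'a \<Rightarrow> 'a" (infixl "\<cdot>\<index>" 70)
  unity :: 'a ("\<one>\<index>")

record (overloaded) ('a :: complex_vector) bialg = "'a alg" +
  comult :: "'a \<Rightarrow> 'a \<otimes> 'a"
  counit :: "'a \<Rightarrow> complex"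

record (overloaded) ('a :: complex_vector) hopf = "'a bialg" +
  antipode :: "'a \<Rightarrow> 'a"

definition algebra :: "('a :: complex_vector, 'm) alg_scheme \<Rightarrow> bool"
  where "algebra A \<longleftrightarrow>
    cbilinear (mult A) \<and>
    (\<forall>x y z. (x \<cdot>\<^bsub>A\<^esub> y) \<cdot>\<^bsub>A\<^esub> z = x \<cdot>\<^bsub>A\<^esub> (y \<cdot>\<^bsub>A\<^esub> z)) \<and>
    (\<forall>x. \<one>\<^bsub>A\<^esub> \<cdot>\<^bsub>A\<^esub> x = x \<and> x \<cdot>\<^bsub>A\<^esub> \<one>\<^bsub>A\<^esub> = x)"

text \<open>
  Sweedler notation: for bilinear \<open>f\<close>, \<open>sweedler A x f\<close> is the sum of
  \<open>f x1 x2\<close> over the comultiplication of \<open>x\<close>; \<open>sweedler3\<close> is the version for trilinear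
  \<open>f\<close>, splitting the right-hand factor once more.
\<close>

definition sweedler ::
    "('a :: complex_vector, 'm) bialg_scheme \<Rightarrow> 'a \<Rightarrow> ('a \<Rightarrow> 'a \<Rightarrow> 'v :: complex_vector) \<Rightarrow> 'v"
  where "sweedler A x f = tensor_lift f (comult A x)"

definition sweedler3 ::
    "('a :: complex_vector, 'm) bialg_scheme \<Rightarrow> 'a \<Rightarrow> ('a \<Rightarrow> 'a \<Rightarrow> 'a \<Rightarrow> 'v :: complex_vector) \<Rightarrow> 'v"
  where "sweedler3 A x f = sweedler A x (\<lambda>x1 y. sweedler A y (\<lambda>x2 x3. f x1 x2 x3))"

definition coalgebra :: "('a :: complex_vector, 'm) bialg_scheme \<Rightarrow> bool"
  where "coalgebra A \<longleftrightarrow>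
    clinear (comult A) \<and> clinear (counit A) \<and>
    (\<forall>x. tensor_assoc (tensor_map (comult A) id (comult A x)) = tensor_map id (comult A) (comult A x)) \<and>
    (\<forall>x. sweedler A x (\<lambda>x1 x2. counit A x1 *\<^sub>C x2) = x) \<and>
    (\<forall>x. sweedler A x (\<lambda>x1 x2. counit A x2 *\<^sub>C x1) = x)"

definition bialgebra :: "('a :: complex_vector, 'm) bialg_scheme \<Rightarrow> bool"
  where "bialgebra A \<longleftrightarrow>
    algebra A \<and> coalgebra A \<and>
    (\<forall>x y. comult A (x \<cdot>\<^bsub>A\<^esub> y) =
      sweedler A x (\<lambda>x1 x2. sweedler A y (\<lambda>y1 y2. (x1 \<cdot>\<^bsub>A\<^esub> y1) \<otimes> (x2 \<cdot>\<^bsub>A\<^esub> y2)))) \<and>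
    comult A \<one>\<^bsub>A\<^esub> = \<one>\<^bsub>A\<^esub> \<otimes> \<one>\<^bsub>A\<^esub> \<and>
    (\<forall>x y. counit A (x \<cdot>\<^bsub>A\<^esub> y) = counit A x * counit A y) \<and>
    counit A \<one>\<^bsub>A\<^esub> = 1"

definition hopf_algebra :: "('a :: complex_vector, 'm) hopf_scheme \<Rightarrow> bool"
  where "hopf_algebra A \<longleftrightarrow>
    bialgebra A \<and> clinear (antipode A) \<and>
    (\<forall>x. sweedler A x (\<lambda>x1 x2. antipode A x1 \<cdot>\<^bsub>A\<^esub> x2) = counit A x *\<^sub>C \<one>\<^bsub>A\<^esub>) \<and>
    (\<forall>x. sweedler A x (\<lambda>x1 x2. x1 \<cdot>\<^bsub>A\<^esub> antipode A x2) = counit A x *\<^sub>C \<one>\<^bsub>A\<^esub>)"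

definition module_algebra ::
    "('h :: complex_vector, 'm) bialg_scheme \<Rightarrow> ('v :: complex_vector, 'n) alg_scheme \<Rightarrow>
      ('h \<Rightarrow> 'v \<Rightarrow> 'v) \<Rightarrow> bool"
  where "module_algebra H V act \<longleftrightarrow>
    bialgebra H \<and> algebra V \<and> cbilinear act \<and>
    (\<forall>v. act \<one>\<^bsub>H\<^esub> v = v) \<and>
    (\<forall>h k v. act (h \<cdot>\<^bsub>H\<^esub> k) v = act h (act k v)) \<and>
    (\<forall>h v w. act h (v \<cdot>\<^bsub>V\<^esub> w) = sweedler H h (\<lambda>h1 h2. act h1 v \<cdot>\<^bsub>V\<^esub> act h2 w)) \<and>
    (\<forall>h. act h \<one>\<^bsub>V\<^esub> = counit H h *\<^sub>C \<one>\<^bsub>V\<^esub>)"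


section \<open>Pairings and doubles\<close>

definition hopf_pairing ::
    "('a :: complex_vector) hopf \<Rightarrow> ('b :: complex_vector) hopf \<Rightarrow> ('a \<Rightarrow> 'b \<Rightarrow> complex) \<Rightarrow> bool"
  where "hopf_pairing A B \<phi> \<longleftrightarrow>
    cbilinear \<phi> \<and>
    (\<forall>a b b'. \<phi> a (b \<cdot>\<^bsub>B\<^esub> b') = sweedler A a (\<lambda>a1 a2. \<phi> a1 b * \<phi> a2 b')) \<and>
    (\<forall>a a' b. \<phi> (a \<cdot>\<^bsub>A\<^esub> a') b = sweedler B b (\<lambda>b1 b2. \<phi> a b2 * \<phi> a' b1)) \<and>
    (\<forall>a. \<phi> a \<one>\<^bsub>B\<^esub> = counit A a) \<and>
    (\<forall>b. \<phi> \<one>\<^bsub>A\<^esub> b = counit B b)"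

definition quantum_double ::
    "('a :: complex_vector) hopf \<Rightarrow> ('b :: complex_vector) hopf \<Rightarrow> ('a \<Rightarrow> 'b \<Rightarrow> complex) \<Rightarrow>
      ('a \<otimes> 'b) bialg"
  where "quantum_double A B \<phi> =
    \<lparr>mult = (\<lambda>s t. tensor_lift (\<lambda>a b. tensor_lift (\<lambda>a' b'.
        sweedler3 A a' (\<lambda>a1 a2 a3. sweedler3 B b (\<lambda>b1 b2 b3.
          (\<phi> (inv (antipode A) a1) b1 * \<phi> a3 b3) *\<^sub>C ((a \<cdot>\<^bsub>A\<^esub> a2) \<otimes> (b2 \<cdot>\<^bsub>B\<^esub> b'))))) t) s),
     unity = \<one>\<^bsub>A\<^esub> \<otimes> \<one>\<^bsub>B\<^esub>,
     comult = tensor_lift (\<lambda>a b.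
        sweedler A a (\<lambda>a1 a2. sweedler B b (\<lambda>b1 b2. (a1 \<otimes> b1) \<otimes> (a2 \<otimes> b2)))),
     counit = tensor_lift (\<lambda>a b. counit A a * counit B b)\<rparr>"

definition heisenberg_double ::
    "('a :: complex_vector) hopf \<Rightarrow> ('b :: complex_vector) hopf \<Rightarrow> ('a \<Rightarrow> 'b \<Rightarrow> complex) \<Rightarrow>
      ('b \<otimes> 'a) alg"
  where "heisenberg_double A B \<phi> =
    \<lparr>mult = (\<lambda>s t. tensor_lift (\<lambda>b a. tensor_lift (\<lambda>b' a'.
        sweedler A a (\<lambda>a1 a2. sweedler B b' (\<lambda>b1 b2.
          \<phi> a1 b1 *\<^sub>C ((b \<cdot>\<^bsub>B\<^esub> b2) \<otimes> (a2 \<cdot>\<^bsub>A\<^esub> a'))))) t) s),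
     unity = \<one>\<^bsub>B\<^esub> \<otimes> \<one>\<^bsub>A\<^esub>\<rparr>"

text \<open>
  The Schroedinger representations: the action of \<open>a \<otimes> b\<close> is that of \<open>b\<close> followed by
  that of \<open>a\<close>, since \<open>a \<otimes> b = (a \<otimes> 1)(1 \<otimes> b)\<close> in the quantum double.
\<close>

definition schrodinger_A ::
    "('a :: complex_vector) hopf \<Rightarrow> ('b :: complex_vector) hopf \<Rightarrow> ('a \<Rightarrow> 'b \<Rightarrow> complex) \<Rightarrow>
      'a \<otimes> 'b \<Rightarrow> 'a \<Rightarrow> 'a"
  where "schrodinger_A A B \<phi> h x = tensor_lift (\<lambda>a b.
    (let y = sweedler A x (\<lambda>x1 x2. \<phi> x1 (antipode B b) *\<^sub>C x2)
     in sweedler A a (\<lambda>a1 a2. a1 \<cdot>\<^bsub>A\<^esub> y \<cdot>\<^bsub>A\<^esub> antipode A a2))) h"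

definition schrodinger_B ::
    "('a :: complex_vector) hopf \<Rightarrow> ('b :: complex_vector) hopf \<Rightarrow> ('a \<Rightarrow> 'b \<Rightarrow> complex) \<Rightarrow>
      'a \<otimes> 'b \<Rightarrow> 'b \<Rightarrow> 'b"
  where "schrodinger_B A B \<phi> h y = tensor_lift (\<lambda>a b.
    (let z = sweedler B b (\<lambda>b1 b2. b1 \<cdot>\<^bsub>B\<^esub> y \<cdot>\<^bsub>B\<^esub> antipode B b2)
     in sweedler B z (\<lambda>z1 z2. \<phi> a z1 *\<^sub>C z2))) h"

definition diagonal_action ::
    "('a :: complex_vector) hopf \<Rightarrow> ('b :: complex_vector) hopf \<Rightarrow> ('a \<Rightarrow> 'b \<Rightarrow> complex) \<Rightarrow>
      'a \<otimes> 'b \<Rightarrow> 'b \<otimes> 'a \<Rightarrow> 'b \<otimes> 'a"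
  where "diagonal_action A B \<phi> h u = tensor_lift (\<lambda>a b. tensor_lift (\<lambda>b' a'.
    sweedler A a (\<lambda>a1 a2. sweedler B b (\<lambda>b1 b2.
      schrodinger_B A B \<phi> (a1 \<otimes> b1) b' \<otimes> schrodinger_A A B \<phi> (a2 \<otimes> b2) a'))) u) h"

end

theory Submission
  imports Defs
begin

text \<open>
  The proof rests on the observation that the diagonal action is an inner action: the quantum double
  acts on the Heisenberg double \<open>H\<close> by conjugation inside \<open>H\<close>.

  Both \<open>A\<close> and \<open>B\<close> embed into \<open>H\<close> as subalgebras, with \<open>b \<sharp> a = b a\<close> and the commutation relation
  \<open>a b = \<Sum> \<phi>(a1, b1) b2 a2\<close>. Using this relation and the antipode identity, one finds
  \<open>\<Sum> a1 y S(a2) = \<Sum> \<phi>(a, y1) y2\<close> for \<open>y\<close> in \<open>B\<close> and \<open>\<Sum> b1 x S(b2) = \<Sum> \<phi>(x1, S(b)) x2\<close> for \<open>x\<close> in \<open>A\<close>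
  (\<open>env_act_A_emb_B\<close>, \<open>env_act_B_emb_A\<close>). So all four formulas of the Schroedinger representations
  are adjoint actions inside \<open>H\<close>, and the diagonal action of \<open>a \<otimes> b\<close> is
  \<open>u \<mapsto> \<Sum> a1 b1 u S(b2) S(a2)\<close> (\<open>diagonal_action_eq_ad\<close>). Such an action respects products and the
  unit of \<open>H\<close> because the maps \<open>a \<otimes> b \<mapsto> a b\<close> and \<open>a \<otimes> b \<mapsto> S(b) S(a)\<close> are convolution inverses of each
  other (\<open>adjoint_act_mult\<close>).

  That it is an action of the quantum double follows once the map \<open>\<Theta>\<close> (\<open>env_embed\<close>) given by
  \<open>\<Theta>(a \<otimes> b) = \<Sum> a1 b1 \<otimes> S(b2) S(a2)\<close>, with values in the enveloping algebra of \<open>H\<close>, is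
  known to be multiplicative. In the convolution algebra over the coalgebra \<open>A \<otimes> B\<close>, the commutation relation says
  that \<open>a b\<close> is the convolution of \<open>\<phi>\<close> with \<open>b a\<close>. Taking inverses, \<open>S(a) S(b)\<close> is the convolution of
  \<open>S(b) S(a)\<close> with \<open>\<phi>\<close>. Hence interchanging \<open>a\<close> and \<open>b\<close> in both components of \<open>\<Theta>\<close> conjugates it by
  \<open>\<phi>\<close>, which is the multiplication rule of the quantum double (\<open>env_embed_exchange\<close>). As \<open>\<phi>\<close> is
  invertible, \<open>\<Theta>\<close> is injective, and the quantum double inherits associativity and unit from the
  enveloping algebra. Its comultiplication is multiplicative because conjugation by \<open>\<phi>\<close> is a coalgebra
  morphism (\<open>sweedler_exchange\<close>).

  Passing to the single coalgebra \<open>A \<otimes> B\<close> thus replaces nearly all manipulations of nested Sweedler sums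
  by associativity of convolution and cancellation of inverses.
\<close>

section \<open>Multilinear maps and tensors\<close>

text \<open>
  Sweedler sums are meaningful only for multilinear summands, so nearly every step below has
  linearity side conditions. The rules collected here decompose them along the syntax of the
  summand; a rule about a bilinear operation is stated for that operation, since a rule with a
  variable in head position would apply everywhere and make the decomposition loop.
\<close>

named_theorems lin

lemma clinearI:
  assumes "\<And>x y. f (x + y) = f x + f y" "\<And>c x. f (c *\<^sub>C x) = c *\<^sub>C f x"
  shows "clinear f"
  using assms by (simp add: clinear_iff)

lemma cbilinearI [lin]:
  assumes "\<And>x. clinear (\<lambda>y. f x y)" "\<And>y. clinear (\<lambda>x. f x y)"
  shows "cbilinear f"
  using assms by (simp add: cbilinear_def)

lemma
  assumes "clinear f"
  shows clinear_add: "f (x + y) = f x + f y"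
    and clinear_scale: "f (c *\<^sub>C x) = c *\<^sub>C f x"
    and clinear_zero: "f 0 = 0"
proof -
  show *: "f (x + y) = f x + f y" for x y
    using assms by (simp add: clinear_iff)
  show "f (c *\<^sub>C x) = c *\<^sub>C f x"
    using assms by (simp add: clinear_iff)
  show "f 0 = 0"
    using *[of 0 0] by simp
qed

lemma clinear_ident [lin]: "clinear (\<lambda>x. x)"
  by (simp add: clinear_iff)

lemma clinear_compose: "clinear g \<Longrightarrow> clinear f \<Longrightarrow> clinear (\<lambda>x. g (f x))"
  by (simp add: clinear_iff)

lemma cbilinear_left: "cbilinear g \<Longrightarrow> clinear f \<Longrightarrow> clinear (\<lambda>x. g (f x) c)"
  by (simp add: cbilinear_def clinear_iff)

lemma cbilinear_right: "cbilinear g \<Longrightarrow> clinear f \<Longrightarrow> clinear (\<lambda>x. g c (f x))"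
  by (simp add: cbilinear_def clinear_iff)

lemma cbilinear_scale:
  assumes "cbilinear f"
  shows "f (c *\<^sub>C x) y = c *\<^sub>C f x y" "f x (c *\<^sub>C y) = c *\<^sub>C f x y"
  using assms by (simp_all add: cbilinear_def clinear_iff)

lemma cbilinear_scaleC: "cbilinear (scaleC :: complex \<Rightarrow> 'a \<Rightarrow> 'a :: complex_vector)"
  by (simp add: cbilinear_def clinear_iff scaleC_add_left scaleC_add_right scaleC_scaleC
      scaleC_complex_def mult.commute)

lemma cbilinear_times: "cbilinear ((*) :: complex \<Rightarrow> _)"
  by (simp add: cbilinear_def clinear_iff scaleC_complex_def algebra_simps)

lemmas [lin] =
  cbilinear_scaleC[THEN cbilinear_left] cbilinear_scaleC[THEN cbilinear_right]
  cbilinear_times[THEN cbilinear_left] cbilinear_times[THEN cbilinear_right]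
  cbilinear_pure_tensor[THEN cbilinear_left] cbilinear_pure_tensor[THEN cbilinear_right]

text \<open>
  This is how identities about tensors are reduced to pure tensors throughout: every tensor is a
  sum of pure ones.
\<close>

lemma tensor_linear_eqI:
  fixes f g :: "'a :: complex_vector \<otimes> 'b :: complex_vector \<Rightarrow> 'c :: complex_vector"
  assumes "clinear f" "clinear g" "\<And>x y. f (x \<otimes> y) = g (x \<otimes> y)"
  shows "f t = g t"
  by (induction t rule: tensor_induct)
    (simp_all add: assms clinear_add[OF assms(1)] clinear_add[OF assms(2)]
      clinear_zero[OF assms(1)] clinear_zero[OF assms(2)])

lemma tensor_bilinear_eqI:
  fixes f g :: "'a :: complex_vector \<otimes> 'b :: complex_vector \<Rightarrow>
    'c :: complex_vector \<otimes> 'd :: complex_vector \<Rightarrow> 'v :: complex_vector"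
  assumes "cbilinear f" "cbilinear g" "\<And>x y u v. f (x \<otimes> y) (u \<otimes> v) = g (x \<otimes> y) (u \<otimes> v)"
  shows "f s t = g s t"
proof (rule tensor_linear_eqI[of _ _ s])
  show "clinear (\<lambda>s. f s t)" "clinear (\<lambda>s. g s t)"
    using assms by (simp_all add: cbilinear_def)
  show "f (x \<otimes> y) t = g (x \<otimes> y) t" for x y
    by (rule tensor_linear_eqI[of _ _ t]) (use assms in \<open>simp_all add: cbilinear_def\<close>)
qed

lemma tensor_lift_linear_arg [lin]:
  "cbilinear f \<Longrightarrow> clinear t \<Longrightarrow> clinear (\<lambda>x. tensor_lift f (t x))"
  by (rule clinear_compose[OF clinear_tensor_lift])

lemma tensor_lift_pull:
  assumes "clinear g" "cbilinear f"
  shows "g (tensor_lift f t) = tensor_lift (\<lambda>x y. g (f x y)) t"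
proof -
  have gf: "cbilinear (\<lambda>x y. g (f x y))"
    using assms by (simp add: cbilinear_def clinear_iff)
  show ?thesis
    by (rule tensor_linear_eqI)
      (simp_all add: assms gf clinear_compose clinear_tensor_lift)
qed

lemma tensor_lift_linear_fun [lin]:
  assumes bil: "\<And>x. cbilinear (f x)" and lin: "\<And>p q. clinear (\<lambda>x. f x p q)"
  shows "clinear (\<lambda>x. tensor_lift (f x) t)"
proof (induction t rule: tensor_induct)
  case zero
  then show ?case
    by (simp add: clinear_zero[OF clinear_tensor_lift[OF bil]] clinear_iff)
next
  case (pure p q)
  then show ?case
    by (simp add: bil lin)
next
  case (add s t)
  then show ?case
    by (simp add: clinear_add[OF clinear_tensor_lift[OF bil]] clinear_iff scaleC_add_right)
qed

text \<open>
  The abstract form of exchanging two independent Sweedler sums.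
\<close>

lemma tensor_lift_commute:
  assumes "\<And>x y u. clinear (\<lambda>v. F x y u v)" "\<And>x y v. clinear (\<lambda>u. F x y u v)"
    and "\<And>x u v. clinear (\<lambda>y. F x y u v)" "\<And>y u v. clinear (\<lambda>x. F x y u v)"
  shows "tensor_lift (\<lambda>x y. tensor_lift (\<lambda>u v. F x y u v) t) s =
    tensor_lift (\<lambda>u v. tensor_lift (\<lambda>x y. F x y u v) s) t"
  by (rule tensor_linear_eqI[of _ _ s]; (intro lin assms)?)
    (subst (1 2) tensor_lift_pure; (intro lin assms refl)?)

lemma tensor_lift_pure_tensor: "tensor_lift pure_tensor t = t"
  by (rule tensor_linear_eqI) (simp_all add: cbilinear_pure_tensor clinear_tensor_lift lin)

lemma tensor_map_pure:
  assumes "clinear f" "clinear g"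
  shows "tensor_map f g (x \<otimes> y) = f x \<otimes> g y"
  unfolding tensor_map_def
  by (rule tensor_lift_pure) (intro lin assms)

lemma clinear_tensor_map:
  assumes "clinear f" "clinear g"
  shows "clinear (tensor_map f g)"
  unfolding tensor_map_def
  by (rule clinear_tensor_lift) (intro lin assms)

lemma tensor_assoc_pure: "tensor_assoc ((x \<otimes> y) \<otimes> z) = x \<otimes> y \<otimes> z"
  unfolding tensor_assoc_def
  by (subst tensor_lift_pure, (intro lin)[1])+ simp

lemma clinear_tensor_assoc: "clinear tensor_assoc"
  unfolding tensor_assoc_def
  by (rule clinear_tensor_lift) (intro lin)

section \<open>Sweedler calculus\<close>

lemma sweedler_linear_arg [lin]:
  assumes "clinear (comult C)" "cbilinear f" "clinear t"
  shows "clinear (\<lambda>x. sweedler C (t x) f)"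
  unfolding sweedler_def
  by (intro lin assms clinear_compose[of "comult C"])

lemma sweedler_linear_fun [lin]:
  assumes "\<And>x. cbilinear (f x)" "\<And>p q. clinear (\<lambda>x. f x p q)"
  shows "clinear (\<lambda>x. sweedler C c (f x))"
  unfolding sweedler_def by (intro lin assms)

lemma sweedler_cong: "(\<And>x y. f x y = g x y) \<Longrightarrow> sweedler C c f = sweedler C c g"
  by presburger

lemma sweedler_pull:
  assumes "clinear g" "cbilinear f"
  shows "g (sweedler C c f) = sweedler C c (\<lambda>u v. g (f u v))"
  unfolding sweedler_def by (rule tensor_lift_pull[OF assms])

lemma sweedler_commute:
  assumes "\<And>x y u. clinear (\<lambda>v. F x y u v)" "\<And>x y v. clinear (\<lambda>u. F x y u v)"
    and "\<And>x u v. clinear (\<lambda>y. F x y u v)" "\<And>y u v. clinear (\<lambda>x. F x y u v)"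
  shows "sweedler C c (\<lambda>x y. sweedler D d (\<lambda>u v. F x y u v)) =
    sweedler D d (\<lambda>u v. sweedler C c (\<lambda>x y. F x y u v))"
  unfolding sweedler_def by (rule tensor_lift_commute) (rule assms)+

lemma coalgebra_linear:
  assumes "coalgebra C"
  shows "clinear (comult C)" "clinear (counit C)"
  using assms by (simp_all add: coalgebra_def)

lemma sweedler_pure_tensor: "sweedler C c pure_tensor = comult C c"
  by (simp add: sweedler_def tensor_lift_pure_tensor)

text \<open>
  Coassociativity is formulated with induced maps between threefold tensor products. The next two
  lemmas rewrite its two sides as Sweedler sums; applying a linear map out of the threefold tensor
  product then gives the rule for an arbitrary trilinear summand.
\<close>

lemma comult_assoc_left:
  assumes C: "clinear (comult C)"
  shows "tensor_assoc (tensor_map (comult C) id (comult C c)) =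
    sweedler C c (\<lambda>u z. sweedler C u (\<lambda>x y. x \<otimes> y \<otimes> z))"
proof -
  have G: "clinear (\<lambda>t. tensor_assoc (tensor_map (comult C) id t))"
    by (intro clinear_compose[OF clinear_tensor_assoc] clinear_tensor_map C clinear_ident[folded id_def])
  have "tensor_assoc (comult C u \<otimes> z) = sweedler C u (\<lambda>x y. x \<otimes> y \<otimes> z)" for u z :: 'a
  proof -
    have "clinear (\<lambda>t. tensor_assoc (t \<otimes> z) :: 'a \<otimes> 'a \<otimes> 'a)"
      by (intro clinear_compose[OF clinear_tensor_assoc] lin)
    from sweedler_pull[OF this cbilinear_pure_tensor, of C u] show ?thesis
      by (simp add: sweedler_pure_tensor tensor_assoc_pure)
  qed
  with sweedler_pull[OF G cbilinear_pure_tensor, of C c] show ?thesis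
    by (simp add: sweedler_pure_tensor tensor_map_pure C clinear_ident[folded id_def])
qed

lemma comult_assoc_right:
  assumes C: "clinear (comult C)"
  shows "tensor_map id (comult C) (comult C c) =
    sweedler C c (\<lambda>x v. sweedler C v (\<lambda>y z. x \<otimes> y \<otimes> z))"
proof -
  have G: "clinear (tensor_map id (comult C))"
    by (intro clinear_tensor_map C clinear_ident[folded id_def])
  have "x \<otimes> comult C v = sweedler C v (\<lambda>y z. x \<otimes> y \<otimes> z)" for x v :: 'a
  proof -
    have "clinear (\<lambda>t. x \<otimes> t :: 'a \<otimes> 'a \<otimes> 'a)"
      by (intro lin)
    from sweedler_pull[OF this cbilinear_pure_tensor, of C v] show ?thesis
      by (simp add: sweedler_pure_tensor)
  qed
  with sweedler_pull[OF G cbilinear_pure_tensor, of C c] show ?thesis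
    by (simp add: sweedler_pure_tensor tensor_map_pure C clinear_ident[folded id_def])
qed

lemma sweedler_coassoc:
  assumes C: "coalgebra C"
    and F: "\<And>x y. clinear (\<lambda>z. F x y z)" "\<And>x z. clinear (\<lambda>y. F x y z)"
      "\<And>y z. clinear (\<lambda>x. F x y z)"
  shows "sweedler C c (\<lambda>u z. sweedler C u (\<lambda>x y. F x y z)) =
    sweedler C c (\<lambda>x v. sweedler C v (\<lambda>y z. F x y z))"
proof -
  note lin' = lin coalgebra_linear[OF C] F
  let ?L = "tensor_lift (\<lambda>x w. tensor_lift (\<lambda>y z. F x y z) w)"
  have L: "clinear ?L"
    by (rule clinear_tensor_lift) (intro lin')
  have L_pure: "?L (x \<otimes> y \<otimes> z) = F x y z" for x y z
    by (subst tensor_lift_pure, (intro lin')[1])+ simp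
  have "sweedler C c (\<lambda>u z. sweedler C u (\<lambda>x y. F x y z)) =
    ?L (sweedler C c (\<lambda>u z. sweedler C u (\<lambda>x y. x \<otimes> y \<otimes> z)))"
    by (subst sweedler_pull[OF L], (intro lin')[1])+ (simp only: L_pure)
  also have "\<dots> = ?L (sweedler C c (\<lambda>x v. sweedler C v (\<lambda>y z. x \<otimes> y \<otimes> z)))"
    using C comult_assoc_left[of C c] comult_assoc_right[of C c] by (simp add: coalgebra_def)
  also have "\<dots> = sweedler C c (\<lambda>x v. sweedler C v (\<lambda>y z. F x y z))"
    by (subst sweedler_pull[OF L], (intro lin')[1])+ (simp only: L_pure)
  finally show ?thesis .
qed

lemma sweedler_counit_left:
  assumes "coalgebra C" "clinear f"
  shows "sweedler C c (\<lambda>x y. counit C x *\<^sub>C f y) = f c"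
proof -
  note lin' = lin coalgebra_linear[OF assms(1)] clinear_compose[OF coalgebra_linear(2)[OF assms(1)]]
  have "f c = f (sweedler C c (\<lambda>x y. counit C x *\<^sub>C y))"
    using assms(1) by (simp add: coalgebra_def)
  also have "\<dots> = sweedler C c (\<lambda>x y. f (counit C x *\<^sub>C y))"
    by (rule sweedler_pull[OF assms(2)]) (intro lin')
  finally show ?thesis
    by (simp add: clinear_scale[OF assms(2)])
qed

lemma sweedler_counit_right:
  assumes "coalgebra C" "clinear f"
  shows "sweedler C c (\<lambda>x y. counit C y *\<^sub>C f x) = f c"
proof -
  note lin' = lin coalgebra_linear[OF assms(1)] clinear_compose[OF coalgebra_linear(2)[OF assms(1)]]
  have "f c = f (sweedler C c (\<lambda>x y. counit C y *\<^sub>C x))"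
    using assms(1) by (simp add: coalgebra_def)
  also have "\<dots> = sweedler C c (\<lambda>x y. f (counit C y *\<^sub>C x))"
    by (rule sweedler_pull[OF assms(2)]) (intro lin')
  finally show ?thesis
    by (simp add: clinear_scale[OF assms(2)])
qed

section \<open>Convolution\<close>

text \<open>
  The factors \<open>f\<close> and \<open>g\<close> may have different target spaces, combined by a bilinear map \<open>\<beta>\<close>. This
  covers the convolution algebra of maps into an algebra, its actions on vector-valued maps by
  scalar-valued ones (\<open>\<beta> = scaleC\<close> and its flip), and the map \<open>\<Sum> f c1 \<otimes> g c2\<close>
  (\<open>\<beta> = pure_tensor\<close>).
\<close>

definition conv ::
    "('c :: complex_vector, 'm) bialg_scheme \<Rightarrow>
      ('u :: complex_vector \<Rightarrow> 'v :: complex_vector \<Rightarrow> 'w :: complex_vector) \<Rightarrow>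
      ('c \<Rightarrow> 'u) \<Rightarrow> ('c \<Rightarrow> 'v) \<Rightarrow> 'c \<Rightarrow> 'w"
  where "conv C \<beta> f g c = sweedler C c (\<lambda>x y. \<beta> (f x) (g y))"

lemma cbilinear_compose:
  assumes "cbilinear \<beta>" "clinear f" "clinear g"
  shows "cbilinear (\<lambda>x y. \<beta> (f x) (g y))"
  using assms by (simp add: cbilinear_def clinear_iff)

lemma clinear_conv:
  assumes "coalgebra C" "cbilinear \<beta>" "clinear f" "clinear g"
  shows "clinear (conv C \<beta> f g)"
  unfolding conv_def
  by (intro lin coalgebra_linear(1) cbilinear_compose[OF assms(2)] assms)

lemma conv_pull:
  assumes "clinear G" "cbilinear \<beta>" "clinear f" "clinear g"
  shows "G (conv C \<beta> f g c) = conv C (\<lambda>x y. G (\<beta> x y)) f g c"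
  unfolding conv_def
  by (rule sweedler_pull) (intro cbilinear_compose[OF assms(2)] assms)+

text \<open>
  Associativity of convolution is coassociativity, as soon as the two ways to combine three values
  agree. Being stated for four different bilinear maps, the rule moves a scalar-valued factor in
  or out of any convolution.
\<close>

lemma conv_assoc:
  assumes C: "coalgebra C"
    and bil: "cbilinear \<beta>" "cbilinear \<gamma>" "cbilinear \<gamma>'" "cbilinear \<beta>'"
    and lin_fgh: "clinear f" "clinear g" "clinear h"
    and assoc: "\<And>x y z. \<beta> (\<gamma> x y) z = \<gamma>' x (\<beta>' y z)"
  shows "conv C \<beta> (conv C \<gamma> f g) h = conv C \<gamma>' f (conv C \<beta>' g h)"
proof
  fix c
  note lin' = lin lin_fgh bil bil[THEN cbilinear_left] bil[THEN cbilinear_right]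
    lin_fgh[THEN clinear_compose] coalgebra_linear(1)[OF C]
  have "conv C \<beta> (conv C \<gamma> f g) h c =
    sweedler C c (\<lambda>u z. sweedler C u (\<lambda>x y. \<beta> (\<gamma> (f x) (g y)) (h z)))"
    unfolding conv_def
    by (subst sweedler_pull[of "\<lambda>s. \<beta> s (h z)" for z]) (intro lin' refl)+
  also have "\<dots> = sweedler C c (\<lambda>x v. sweedler C v (\<lambda>y z. \<beta> (\<gamma> (f x) (g y)) (h z)))"
    by (rule sweedler_coassoc[OF C]) (intro lin')+
  also have "\<dots> = conv C \<gamma>' f (conv C \<beta>' g h) c"
    unfolding conv_def assoc
    by (subst sweedler_pull[of "\<lambda>s. \<gamma>' (f x) s" for x]) (intro lin' refl)+
  finally show "conv C \<beta> (conv C \<gamma> f g) h c = conv C \<gamma>' f (conv C \<beta>' g h) c" .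
qed

lemma conv_counit_left:
  assumes C: "coalgebra C" and g: "clinear g" and \<beta>: "cbilinear \<beta>"
  shows "conv C \<beta> (\<lambda>c. counit C c *\<^sub>C e) g c = \<beta> e (g c)"
proof -
  have "\<beta> (r *\<^sub>C e) y = r *\<^sub>C \<beta> e y" for r y
    by (rule cbilinear_scale[OF \<beta>])
  then show ?thesis
    using sweedler_counit_left[OF C cbilinear_right[OF \<beta> g]] by (simp add: conv_def)
qed

lemma conv_counit_right:
  assumes C: "coalgebra C" and f: "clinear f" and \<beta>: "cbilinear \<beta>"
  shows "conv C \<beta> f (\<lambda>c. counit C c *\<^sub>C e) c = \<beta> (f c) e"
proof -
  have "\<beta> x (r *\<^sub>C e) = r *\<^sub>C \<beta> x e" for r x
    by (rule cbilinear_scale[OF \<beta>])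
  then show ?thesis
    using sweedler_counit_right[OF C cbilinear_left[OF \<beta> f]] by (simp add: conv_def)
qed

lemma conv_counit_scaleC:
  assumes "coalgebra C" "clinear g"
  shows "conv C scaleC (counit C) g = g"
    and "conv C (\<lambda>x r. r *\<^sub>C x) g (counit C) = g"
  using sweedler_counit_left[OF assms] sweedler_counit_right[OF assms]
  by (simp_all add: conv_def fun_eq_iff)

lemma algebraD:
  assumes "algebra E"
  shows "cbilinear (mult E)" "(x \<cdot>\<^bsub>E\<^esub> y) \<cdot>\<^bsub>E\<^esub> z = x \<cdot>\<^bsub>E\<^esub> (y \<cdot>\<^bsub>E\<^esub> z)"
    "\<one>\<^bsub>E\<^esub> \<cdot>\<^bsub>E\<^esub> x = x" "x \<cdot>\<^bsub>E\<^esub> \<one>\<^bsub>E\<^esub> = x"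
  using assms by (simp_all add: algebra_def)

lemma mult_linear:
  assumes "algebra E" "clinear f"
  shows "clinear (\<lambda>x. f x \<cdot>\<^bsub>E\<^esub> y)" "clinear (\<lambda>x. y \<cdot>\<^bsub>E\<^esub> f x)"
  using cbilinear_left[OF algebraD(1)] cbilinear_right[OF algebraD(1)] assms by blast+

lemma mult_scaleC:
  assumes "algebra E"
  shows "(c *\<^sub>C x) \<cdot>\<^bsub>E\<^esub> y = c *\<^sub>C (x \<cdot>\<^bsub>E\<^esub> y)" "x \<cdot>\<^bsub>E\<^esub> (c *\<^sub>C y) = c *\<^sub>C (x \<cdot>\<^bsub>E\<^esub> y)"
  by (rule cbilinear_scale[OF algebraD(1)[OF assms]])+

text \<open>
  In a monoid a left inverse and a right inverse of the same element coincide.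
\<close>

lemma conv_inverse_unique:
  assumes C: "coalgebra C" and E: "algebra E"
    and lin_fgh: "clinear f" "clinear g" "clinear h"
    and fg: "conv C (mult E) f g = (\<lambda>c. counit C c *\<^sub>C \<one>\<^bsub>E\<^esub>)"
    and gh: "conv C (mult E) g h = (\<lambda>c. counit C c *\<^sub>C \<one>\<^bsub>E\<^esub>)"
  shows "f = h"
proof
  fix c
  note bil = algebraD(1)[OF E]
  have "conv C (mult E) (conv C (mult E) f g) h = conv C (mult E) f (conv C (mult E) g h)"
    by (rule conv_assoc[OF C bil bil bil bil lin_fgh]) (simp add: algebraD[OF E])
  then have "conv C (mult E) (conv C (mult E) f g) h c = conv C (mult E) f (conv C (mult E) g h) c"
    by simp
  then show "f c = h c"
    using conv_counit_left[OF C lin_fgh(3) bil, of "\<one>\<^bsub>E\<^esub>" c]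
      conv_counit_right[OF C lin_fgh(1) bil, of "\<one>\<^bsub>E\<^esub>" c]
    by (simp add: fg gh algebraD[OF E])
qed

section \<open>Tensor products of algebras and coalgebras\<close>

text \<open>
  All multiplications on tensor products below have this shape.
\<close>

lemma tensor_lift_tensor_lift:
  fixes F :: "'a :: complex_vector \<Rightarrow> 'b :: complex_vector \<Rightarrow> 'c :: complex_vector \<Rightarrow>
    'd :: complex_vector \<Rightarrow> 'v :: complex_vector"
  assumes F: "\<And>x y u. clinear (\<lambda>v. F x y u v)" "\<And>x y v. clinear (\<lambda>u. F x y u v)"
    "\<And>x u v. clinear (\<lambda>y. F x y u v)" "\<And>y u v. clinear (\<lambda>x. F x y u v)"
  shows "cbilinear (\<lambda>s t. tensor_lift (\<lambda>x y. tensor_lift (\<lambda>u v. F x y u v) t) s)"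
    and "tensor_lift (\<lambda>x y. tensor_lift (\<lambda>u v. F x y u v) (u0 \<otimes> v0)) (x0 \<otimes> y0) = F x0 y0 u0 v0"
proof -
  show "cbilinear (\<lambda>s t. tensor_lift (\<lambda>x y. tensor_lift (\<lambda>u v. F x y u v) t) s)"
    by (intro lin F)
  show "tensor_lift (\<lambda>x y. tensor_lift (\<lambda>u v. F x y u v) (u0 \<otimes> v0)) (x0 \<otimes> y0) = F x0 y0 u0 v0"
    by (subst tensor_lift_pure, (intro lin F)[1])+ (rule refl)
qed

definition tensor_algebra ::
    "('p :: complex_vector, 'm) alg_scheme \<Rightarrow> ('q :: complex_vector, 'n) alg_scheme \<Rightarrow> ('p \<otimes> 'q) alg"
  where "tensor_algebra P Q =
    \<lparr>mult = (\<lambda>s t. tensor_lift (\<lambda>x y. tensor_lift (\<lambda>u v. (x \<cdot>\<^bsub>P\<^esub> u) \<otimes> (y \<cdot>\<^bsub>Q\<^esub> v)) t) s),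
     unity = \<one>\<^bsub>P\<^esub> \<otimes> \<one>\<^bsub>Q\<^esub>\<rparr>"

lemma
  assumes P: "algebra P" and Q: "algebra Q"
  shows tensor_algebra_mult_pure:
      "(x \<otimes> y) \<cdot>\<^bsub>tensor_algebra P Q\<^esub> (u \<otimes> v) = (x \<cdot>\<^bsub>P\<^esub> u) \<otimes> (y \<cdot>\<^bsub>Q\<^esub> v)"
    and algebra_tensor_algebra: "algebra (tensor_algebra P Q)"
proof -
  note lin' = lin mult_linear[OF P] mult_linear[OF Q]
  let ?T = "tensor_algebra P Q"
  have bil: "cbilinear (mult ?T)"
    unfolding tensor_algebra_def alg.simps
    by (intro tensor_lift_tensor_lift lin')
  show pure: "(x \<otimes> y) \<cdot>\<^bsub>?T\<^esub> (u \<otimes> v) = (x \<cdot>\<^bsub>P\<^esub> u) \<otimes> (y \<cdot>\<^bsub>Q\<^esub> v)" for x y u v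
    unfolding tensor_algebra_def alg.simps
    by (rule tensor_lift_tensor_lift) (intro lin')+
  note lin'' = lin cbilinear_left[OF bil] cbilinear_right[OF bil]
  have one: "\<one>\<^bsub>?T\<^esub> = \<one>\<^bsub>P\<^esub> \<otimes> \<one>\<^bsub>Q\<^esub>"
    by (simp add: tensor_algebra_def)
  have "(s \<cdot>\<^bsub>?T\<^esub> t) \<cdot>\<^bsub>?T\<^esub> r = s \<cdot>\<^bsub>?T\<^esub> (t \<cdot>\<^bsub>?T\<^esub> r)" for s t r
  proof (rule tensor_bilinear_eqI[of "\<lambda>s t. (s \<cdot>\<^bsub>?T\<^esub> t) \<cdot>\<^bsub>?T\<^esub> r" "\<lambda>s t. s \<cdot>\<^bsub>?T\<^esub> (t \<cdot>\<^bsub>?T\<^esub> r)"])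
    show "cbilinear (\<lambda>s t. (s \<cdot>\<^bsub>?T\<^esub> t) \<cdot>\<^bsub>?T\<^esub> r)" "cbilinear (\<lambda>s t. s \<cdot>\<^bsub>?T\<^esub> (t \<cdot>\<^bsub>?T\<^esub> r))"
      by (intro lin'')+
    fix x y u v
    show "((x \<otimes> y) \<cdot>\<^bsub>?T\<^esub> (u \<otimes> v)) \<cdot>\<^bsub>?T\<^esub> r = (x \<otimes> y) \<cdot>\<^bsub>?T\<^esub> ((u \<otimes> v) \<cdot>\<^bsub>?T\<^esub> r)"
      by (rule tensor_linear_eqI[of _ _ r])
        ((intro lin'')[1], (intro lin'')[1], simp add: pure algebraD[OF P] algebraD[OF Q])
  qed
  moreover have "\<one>\<^bsub>?T\<^esub> \<cdot>\<^bsub>?T\<^esub> s = s" for s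
    by (rule tensor_linear_eqI[of _ _ s])
      ((intro lin'')[1], (intro lin'')[1], simp add: pure one algebraD[OF P] algebraD[OF Q])
  moreover have "s \<cdot>\<^bsub>?T\<^esub> \<one>\<^bsub>?T\<^esub> = s" for s
    by (rule tensor_linear_eqI[of _ _ s])
      ((intro lin'')[1], (intro lin'')[1], simp add: pure one algebraD[OF P] algebraD[OF Q])
  ultimately show "algebra ?T"
    using bil by (simp add: algebra_def)
qed

text \<open>
  The quantum double has the same coalgebra structure but a different multiplication, so all
  convolutions on the quantum double are convolutions on this bialgebra.
\<close>

definition tensor_bialgebra ::
    "('a :: complex_vector, 'm) bialg_scheme \<Rightarrow> ('b :: complex_vector, 'n) bialg_scheme \<Rightarrow> ('a \<otimes> 'b) bialg"
  where "tensor_bialgebra A B =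
    \<lparr>mult = mult (tensor_algebra A B), unity = \<one>\<^bsub>tensor_algebra A B\<^esub>,
     comult = tensor_lift (\<lambda>a b.
        sweedler A a (\<lambda>a1 a2. sweedler B b (\<lambda>b1 b2. (a1 \<otimes> b1) \<otimes> (a2 \<otimes> b2)))),
     counit = tensor_lift (\<lambda>a b. counit A a * counit B b)\<rparr>"

context
  fixes A :: "('a :: complex_vector, 'm) bialg_scheme" and B :: "('b :: complex_vector, 'n) bialg_scheme"
  assumes A: "coalgebra A" and B: "coalgebra B"
begin

lemmas lin_AB = lin coalgebra_linear[OF A] coalgebra_linear[OF B]
  coalgebra_linear(2)[OF A, THEN clinear_compose] coalgebra_linear(2)[OF B, THEN clinear_compose]

lemma clinear_comult_tensor: "clinear (comult (tensor_bialgebra A B))"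
  unfolding tensor_bialgebra_def bialg.simps
  by (rule clinear_tensor_lift) (intro lin_AB)

lemma clinear_counit_tensor: "clinear (counit (tensor_bialgebra A B))"
  unfolding tensor_bialgebra_def bialg.simps
  by (rule clinear_tensor_lift) (intro lin_AB)

lemma counit_tensor_pure: "counit (tensor_bialgebra A B) (a \<otimes> b) = counit A a * counit B b"
  unfolding tensor_bialgebra_def bialg.simps
  by (rule tensor_lift_pure) (intro lin_AB)

lemma sweedler_tensor_pure:
  assumes F: "cbilinear F"
  shows "sweedler (tensor_bialgebra A B) (a \<otimes> b) F =
    sweedler A a (\<lambda>a1 a2. sweedler B b (\<lambda>b1 b2. F (a1 \<otimes> b1) (a2 \<otimes> b2)))"
proof -
  have "comult (tensor_bialgebra A B) (a \<otimes> b) =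
    sweedler A a (\<lambda>a1 a2. sweedler B b (\<lambda>b1 b2. (a1 \<otimes> b1) \<otimes> (a2 \<otimes> b2)))"
    unfolding tensor_bialgebra_def bialg.simps
    by (rule tensor_lift_pure) (intro lin_AB)
  then have "sweedler (tensor_bialgebra A B) (a \<otimes> b) F =
    tensor_lift F (sweedler A a (\<lambda>a1 a2. sweedler B b (\<lambda>b1 b2. (a1 \<otimes> b1) \<otimes> (a2 \<otimes> b2))))"
    by (simp add: sweedler_def)
  also have "\<dots> = sweedler A a (\<lambda>a1 a2. sweedler B b (\<lambda>b1 b2. F (a1 \<otimes> b1) (a2 \<otimes> b2)))"
    by (subst sweedler_pull[OF clinear_tensor_lift[OF F]], (intro lin_AB)[1])+
      (simp add: F)
  finally show ?thesis .
qed

text \<open>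
  On a pure tensor an iterated comultiplication splits the two components independently, so
  coassociativity holds because it holds in each component, after the sums have been separated.
\<close>

lemma sweedler_tensor_assoc:
  assumes F: "\<And>r s. clinear (\<lambda>t. F r s t)" "\<And>r t. clinear (\<lambda>s. F r s t)"
      "\<And>s t. clinear (\<lambda>r. F r s t)"
  defines "C \<equiv> tensor_bialgebra A B"
  shows "sweedler C (a \<otimes> b) (\<lambda>r u. sweedler C u (\<lambda>s t. F r s t)) =
    sweedler A a (\<lambda>a1 u. sweedler A u (\<lambda>a2 a3. sweedler B b (\<lambda>b1 v. sweedler B v (\<lambda>b2 b3.
      F (a1 \<otimes> b1) (a2 \<otimes> b2) (a3 \<otimes> b3)))))" (is ?R)
    and "sweedler C (a \<otimes> b) (\<lambda>u t. sweedler C u (\<lambda>r s. F r s t)) =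
    sweedler C (a \<otimes> b) (\<lambda>r u. sweedler C u (\<lambda>s t. F r s t))" (is ?L)
proof -
  note lin' = lin_AB F clinear_comult_tensor F[THEN clinear_compose]
  have "sweedler C (a \<otimes> b) (\<lambda>r u. sweedler C u (\<lambda>s t. F r s t)) =
    sweedler A a (\<lambda>a1 u. sweedler B b (\<lambda>b1 v. sweedler A u (\<lambda>a2 a3. sweedler B v (\<lambda>b2 b3.
      F (a1 \<otimes> b1) (a2 \<otimes> b2) (a3 \<otimes> b3)))))"
    unfolding C_def by (subst sweedler_tensor_pure, (intro lin')[1])+ (rule refl)
  also have "\<dots> = sweedler A a (\<lambda>a1 u. sweedler A u (\<lambda>a2 a3. sweedler B b (\<lambda>b1 v. sweedler B v (\<lambda>b2 b3.
      F (a1 \<otimes> b1) (a2 \<otimes> b2) (a3 \<otimes> b3)))))"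
    by (subst sweedler_commute[of _ B _ A]) (intro lin' refl)+
  finally show R: ?R .
  have "sweedler C (a \<otimes> b) (\<lambda>u t. sweedler C u (\<lambda>r s. F r s t)) =
    sweedler A a (\<lambda>u a3. sweedler B b (\<lambda>v b3. sweedler A u (\<lambda>a1 a2. sweedler B v (\<lambda>b1 b2.
      F (a1 \<otimes> b1) (a2 \<otimes> b2) (a3 \<otimes> b3)))))"
    unfolding C_def by (subst sweedler_tensor_pure, (intro lin')[1])+ (rule refl)
  also have "\<dots> = sweedler A a (\<lambda>u a3. sweedler A u (\<lambda>a1 a2. sweedler B b (\<lambda>v b3. sweedler B v (\<lambda>b1 b2.
      F (a1 \<otimes> b1) (a2 \<otimes> b2) (a3 \<otimes> b3)))))"
    by (subst sweedler_commute[of _ B _ A]) (intro lin' refl)+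
  also have "\<dots> = sweedler A a (\<lambda>u a3. sweedler A u (\<lambda>a1 a2. sweedler B b (\<lambda>b1 v. sweedler B v (\<lambda>b2 b3.
      F (a1 \<otimes> b1) (a2 \<otimes> b2) (a3 \<otimes> b3)))))"
    by (subst sweedler_coassoc[OF B]) (intro lin' refl)+
  also have "\<dots> = sweedler A a (\<lambda>a1 u. sweedler A u (\<lambda>a2 a3. sweedler B b (\<lambda>b1 v. sweedler B v (\<lambda>b2 b3.
      F (a1 \<otimes> b1) (a2 \<otimes> b2) (a3 \<otimes> b3)))))"
    by (rule sweedler_coassoc[OF A]) (intro lin')+
  finally show ?L
    by (simp add: R)
qed

lemma coalgebra_tensor: "coalgebra (tensor_bialgebra A B)"
proof -
  let ?C = "tensor_bialgebra A B"
  note lin' = lin_AB clinear_comult_tensor clinear_counit_tensor clinear_counit_tensor[THEN clinear_compose]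
  have "sweedler ?C c (\<lambda>u t. sweedler ?C u (\<lambda>r s. r \<otimes> s \<otimes> t)) =
    sweedler ?C c (\<lambda>r u. sweedler ?C u (\<lambda>s t. r \<otimes> s \<otimes> t))" for c
  proof (rule tensor_linear_eqI[of _ _ c])
    show "sweedler ?C (a \<otimes> b) (\<lambda>u t. sweedler ?C u (\<lambda>r s. r \<otimes> s \<otimes> t)) =
      sweedler ?C (a \<otimes> b) (\<lambda>r u. sweedler ?C u (\<lambda>s t. r \<otimes> s \<otimes> t))" for a b
      by (rule sweedler_tensor_assoc) (intro lin)+
  qed (intro lin')+
  moreover have "sweedler ?C c (\<lambda>s t. counit ?C s *\<^sub>C t) = c" for c
  proof (rule tensor_linear_eqI[of _ _ c])
    fix a b
    have "sweedler ?C (a \<otimes> b) (\<lambda>s t. counit ?C s *\<^sub>C t) =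
      sweedler A a (\<lambda>a1 a2. sweedler B b (\<lambda>b1 b2. counit B b1 *\<^sub>C (counit A a1 *\<^sub>C (a2 \<otimes> b2))))"
      by (subst sweedler_tensor_pure, (intro lin')[1]) (simp add: counit_tensor_pure scaleC_scaleC mult.commute)
    also have "\<dots> = sweedler A a (\<lambda>a1 a2. counit A a1 *\<^sub>C (a2 \<otimes> b))"
      by (subst sweedler_counit_left[OF B]) (intro lin' refl)+
    also have "\<dots> = a \<otimes> b"
      by (rule sweedler_counit_left[OF A]) (intro lin')
    finally show "sweedler ?C (a \<otimes> b) (\<lambda>s t. counit ?C s *\<^sub>C t) = a \<otimes> b" .
  qed (intro lin')+
  moreover have "sweedler ?C c (\<lambda>s t. counit ?C t *\<^sub>C s) = c" for c
  proof (rule tensor_linear_eqI[of _ _ c])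
    fix a b
    have "sweedler ?C (a \<otimes> b) (\<lambda>s t. counit ?C t *\<^sub>C s) =
      sweedler A a (\<lambda>a1 a2. sweedler B b (\<lambda>b1 b2. counit B b2 *\<^sub>C (counit A a2 *\<^sub>C (a1 \<otimes> b1))))"
      by (subst sweedler_tensor_pure, (intro lin')[1]) (simp add: counit_tensor_pure scaleC_scaleC mult.commute)
    also have "\<dots> = sweedler A a (\<lambda>a1 a2. counit A a2 *\<^sub>C (a1 \<otimes> b))"
      by (subst sweedler_counit_right[OF B]) (intro lin' refl)+
    also have "\<dots> = a \<otimes> b"
      by (rule sweedler_counit_right[OF A]) (intro lin')
    finally show "sweedler ?C (a \<otimes> b) (\<lambda>s t. counit ?C t *\<^sub>C s) = a \<otimes> b" .
  qed (intro lin')+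
  ultimately show ?thesis
    by (simp add: coalgebra_def comult_assoc_left comult_assoc_right
        clinear_comult_tensor clinear_counit_tensor)
qed

end

section \<open>Bialgebras and antipodes\<close>

lemma bialgebraD:
  assumes "bialgebra A"
  shows "algebra A" "coalgebra A"
    "counit A (x \<cdot>\<^bsub>A\<^esub> y) = counit A x * counit A y" "counit A \<one>\<^bsub>A\<^esub> = 1"
    "comult A \<one>\<^bsub>A\<^esub> = \<one>\<^bsub>A\<^esub> \<otimes> \<one>\<^bsub>A\<^esub>"
    "comult A (x \<cdot>\<^bsub>A\<^esub> y) =
      sweedler A x (\<lambda>x1 x2. sweedler A y (\<lambda>y1 y2. (x1 \<cdot>\<^bsub>A\<^esub> y1) \<otimes> (x2 \<cdot>\<^bsub>A\<^esub> y2)))"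
  using assms by (simp_all add: bialgebra_def)

lemma sweedler_mult:
  assumes A: "bialgebra A" and F: "cbilinear F"
  shows "sweedler A (x \<cdot>\<^bsub>A\<^esub> y) F =
    sweedler A x (\<lambda>x1 x2. sweedler A y (\<lambda>y1 y2. F (x1 \<cdot>\<^bsub>A\<^esub> y1) (x2 \<cdot>\<^bsub>A\<^esub> y2)))"
proof -
  note lin' = lin coalgebra_linear[OF bialgebraD(2)[OF A]] mult_linear[OF bialgebraD(1)[OF A]]
  have "sweedler A (x \<cdot>\<^bsub>A\<^esub> y) F = tensor_lift F
    (sweedler A x (\<lambda>x1 x2. sweedler A y (\<lambda>y1 y2. (x1 \<cdot>\<^bsub>A\<^esub> y1) \<otimes> (x2 \<cdot>\<^bsub>A\<^esub> y2))))"
    by (simp add: sweedler_def[of A "x \<cdot>\<^bsub>A\<^esub> y"] bialgebraD(6)[OF A])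
  also have "\<dots> = sweedler A x (\<lambda>x1 x2. sweedler A y (\<lambda>y1 y2. F (x1 \<cdot>\<^bsub>A\<^esub> y1) (x2 \<cdot>\<^bsub>A\<^esub> y2)))"
    by (subst sweedler_pull[OF clinear_tensor_lift[OF F]], (intro lin')[1])+
      (simp add: F)
  finally show ?thesis .
qed

lemma sweedler_one:
  assumes "bialgebra A" "cbilinear F"
  shows "sweedler A \<one>\<^bsub>A\<^esub> F = F \<one>\<^bsub>A\<^esub> \<one>\<^bsub>A\<^esub>"
  using assms(2) by (simp add: sweedler_def bialgebraD(5)[OF assms(1)])

lemma hopf_algebraD:
  assumes "hopf_algebra A"
  shows "bialgebra A" "clinear (antipode A)"
    "sweedler A x (\<lambda>x1 x2. antipode A x1 \<cdot>\<^bsub>A\<^esub> x2) = counit A x *\<^sub>C \<one>\<^bsub>A\<^esub>"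
    "sweedler A x (\<lambda>x1 x2. x1 \<cdot>\<^bsub>A\<^esub> antipode A x2) = counit A x *\<^sub>C \<one>\<^bsub>A\<^esub>"
  using assms by (simp_all add: hopf_algebra_def)

text \<open>
  If \<open>f'\<close> and \<open>g'\<close> are right convolution inverses of \<open>f\<close> and \<open>g\<close>, then \<open>g' b \<cdot> f' a\<close> is one of
  \<open>f a \<cdot> g b\<close>: as for the inverse of a product, the inner pair cancels first. Either of the two
  factors may stand first in the product.
\<close>

lemma
  fixes A :: "('a :: complex_vector, 'm) bialg_scheme" and B :: "('b :: complex_vector, 'n) bialg_scheme"
    and E :: "('e :: complex_vector, 'k) alg_scheme"
  assumes A: "coalgebra A" and B: "coalgebra B" and E: "algebra E"
    and lin_fg: "clinear f" "clinear f'" "clinear g" "clinear g'"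
    and ff': "\<And>a. sweedler A a (\<lambda>x y. f x \<cdot>\<^bsub>E\<^esub> f' y) = counit A a *\<^sub>C \<one>\<^bsub>E\<^esub>"
    and gg': "\<And>b. sweedler B b (\<lambda>x y. g x \<cdot>\<^bsub>E\<^esub> g' y) = counit B b *\<^sub>C \<one>\<^bsub>E\<^esub>"
  defines "C \<equiv> tensor_bialgebra A B"
  shows conv_inverse_tensor:
    "conv C (mult E) (tensor_lift (\<lambda>a b. f a \<cdot>\<^bsub>E\<^esub> g b)) (tensor_lift (\<lambda>a b. g' b \<cdot>\<^bsub>E\<^esub> f' a)) =
      (\<lambda>c. counit C c *\<^sub>C \<one>\<^bsub>E\<^esub>)"
    and conv_inverse_tensor_flip:
    "conv C (mult E) (tensor_lift (\<lambda>a b. g b \<cdot>\<^bsub>E\<^esub> f a)) (tensor_lift (\<lambda>a b. f' a \<cdot>\<^bsub>E\<^esub> g' b)) =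
      (\<lambda>c. counit C c *\<^sub>C \<one>\<^bsub>E\<^esub>)"
proof -
  note lin' = lin mult_linear[OF E] lin_fg lin_fg[THEN clinear_compose]
    coalgebra_linear[OF A] coalgebra_linear[OF B]
    clinear_comult_tensor[OF A B] clinear_counit_tensor[OF A B]
    clinear_counit_tensor[OF A B, THEN clinear_compose]
  note E' = algebraD[OF E] mult_scaleC[OF E]
  have lift: "tensor_lift (\<lambda>a b. f a \<cdot>\<^bsub>E\<^esub> g b) (a \<otimes> b) = f a \<cdot>\<^bsub>E\<^esub> g b"
    "tensor_lift (\<lambda>a b. g' b \<cdot>\<^bsub>E\<^esub> f' a) (a \<otimes> b) = g' b \<cdot>\<^bsub>E\<^esub> f' a"
    "tensor_lift (\<lambda>a b. g b \<cdot>\<^bsub>E\<^esub> f a) (a \<otimes> b) = g b \<cdot>\<^bsub>E\<^esub> f a"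
    "tensor_lift (\<lambda>a b. f' a \<cdot>\<^bsub>E\<^esub> g' b) (a \<otimes> b) = f' a \<cdot>\<^bsub>E\<^esub> g' b" for a b
    by (rule tensor_lift_pure, (intro lin')[1])+
  show "conv C (mult E) (tensor_lift (\<lambda>a b. f a \<cdot>\<^bsub>E\<^esub> g b)) (tensor_lift (\<lambda>a b. g' b \<cdot>\<^bsub>E\<^esub> f' a)) =
      (\<lambda>c. counit C c *\<^sub>C \<one>\<^bsub>E\<^esub>)"
    unfolding conv_def C_def
  proof (rule ext, rule tensor_linear_eqI)
    fix a b
    have "sweedler (tensor_bialgebra A B) (a \<otimes> b) (\<lambda>x y. tensor_lift (\<lambda>a b. f a \<cdot>\<^bsub>E\<^esub> g b) x \<cdot>\<^bsub>E\<^esub>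
        tensor_lift (\<lambda>a b. g' b \<cdot>\<^bsub>E\<^esub> f' a) y) =
      sweedler A a (\<lambda>a1 a2. sweedler B b (\<lambda>b1 b2. f a1 \<cdot>\<^bsub>E\<^esub> ((g b1 \<cdot>\<^bsub>E\<^esub> g' b2) \<cdot>\<^bsub>E\<^esub> f' a2)))"
      by (subst sweedler_tensor_pure[OF A B], (intro lin')[1]) (simp add: lift E')
    also have "\<dots> = sweedler A a (\<lambda>a1 a2. f a1 \<cdot>\<^bsub>E\<^esub> (sweedler B b (\<lambda>b1 b2. g b1 \<cdot>\<^bsub>E\<^esub> g' b2) \<cdot>\<^bsub>E\<^esub> f' a2))"
      by (subst sweedler_pull[of "\<lambda>s. f x \<cdot>\<^bsub>E\<^esub> (s \<cdot>\<^bsub>E\<^esub> f' y)" for x y]) (intro lin' refl)+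
    also have "\<dots> = sweedler A a (\<lambda>a1 a2. counit B b *\<^sub>C (f a1 \<cdot>\<^bsub>E\<^esub> f' a2))"
      by (simp add: gg' E')
    also have "\<dots> = counit B b *\<^sub>C (sweedler A a (\<lambda>a1 a2. f a1 \<cdot>\<^bsub>E\<^esub> f' a2))"
      by (rule sweedler_pull[symmetric]) (intro lin')+
    finally show "sweedler (tensor_bialgebra A B) (a \<otimes> b) (\<lambda>x y. tensor_lift (\<lambda>a b. f a \<cdot>\<^bsub>E\<^esub> g b) x \<cdot>\<^bsub>E\<^esub>
        tensor_lift (\<lambda>a b. g' b \<cdot>\<^bsub>E\<^esub> f' a) y) = counit (tensor_bialgebra A B) (a \<otimes> b) *\<^sub>C \<one>\<^bsub>E\<^esub>"
      by (simp add: ff' counit_tensor_pure[OF A B] scaleC_scaleC mult.commute)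
  qed (intro lin')+
  show "conv C (mult E) (tensor_lift (\<lambda>a b. g b \<cdot>\<^bsub>E\<^esub> f a)) (tensor_lift (\<lambda>a b. f' a \<cdot>\<^bsub>E\<^esub> g' b)) =
      (\<lambda>c. counit C c *\<^sub>C \<one>\<^bsub>E\<^esub>)"
    unfolding conv_def C_def
  proof (rule ext, rule tensor_linear_eqI)
    fix a b
    have "sweedler (tensor_bialgebra A B) (a \<otimes> b) (\<lambda>x y. tensor_lift (\<lambda>a b. g b \<cdot>\<^bsub>E\<^esub> f a) x \<cdot>\<^bsub>E\<^esub>
        tensor_lift (\<lambda>a b. f' a \<cdot>\<^bsub>E\<^esub> g' b) y) =
      sweedler A a (\<lambda>a1 a2. sweedler B b (\<lambda>b1 b2. g b1 \<cdot>\<^bsub>E\<^esub> ((f a1 \<cdot>\<^bsub>E\<^esub> f' a2) \<cdot>\<^bsub>E\<^esub> g' b2)))"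
      by (subst sweedler_tensor_pure[OF A B], (intro lin')[1]) (simp add: lift E')
    also have "\<dots> = sweedler B b (\<lambda>b1 b2. sweedler A a (\<lambda>a1 a2. g b1 \<cdot>\<^bsub>E\<^esub> ((f a1 \<cdot>\<^bsub>E\<^esub> f' a2) \<cdot>\<^bsub>E\<^esub> g' b2)))"
      by (rule sweedler_commute) (intro lin')+
    also have "\<dots> = sweedler B b (\<lambda>b1 b2. g b1 \<cdot>\<^bsub>E\<^esub> (sweedler A a (\<lambda>a1 a2. f a1 \<cdot>\<^bsub>E\<^esub> f' a2) \<cdot>\<^bsub>E\<^esub> g' b2))"
      by (subst sweedler_pull[of "\<lambda>s. g x \<cdot>\<^bsub>E\<^esub> (s \<cdot>\<^bsub>E\<^esub> g' y)" for x y]) (intro lin' refl)+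
    also have "\<dots> = sweedler B b (\<lambda>b1 b2. counit A a *\<^sub>C (g b1 \<cdot>\<^bsub>E\<^esub> g' b2))"
      by (simp add: ff' E')
    also have "\<dots> = counit A a *\<^sub>C (sweedler B b (\<lambda>b1 b2. g b1 \<cdot>\<^bsub>E\<^esub> g' b2))"
      by (rule sweedler_pull[symmetric]) (intro lin')+
    finally show "sweedler (tensor_bialgebra A B) (a \<otimes> b) (\<lambda>x y. tensor_lift (\<lambda>a b. g b \<cdot>\<^bsub>E\<^esub> f a) x \<cdot>\<^bsub>E\<^esub>
        tensor_lift (\<lambda>a b. f' a \<cdot>\<^bsub>E\<^esub> g' b) y) = counit (tensor_bialgebra A B) (a \<otimes> b) *\<^sub>C \<one>\<^bsub>E\<^esub>"
      by (simp add: gg' counit_tensor_pure[OF A B] scaleC_scaleC)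
  qed (intro lin')+
qed

context
  fixes A :: "('a :: complex_vector, 'm) hopf_scheme"
  assumes hopf: "hopf_algebra A"
begin

lemmas bialgebra_of_hopf = hopf_algebraD(1)[OF hopf]
lemmas algebra_of_hopf = bialgebraD(1)[OF bialgebra_of_hopf]
lemmas coalgebra_of_hopf = bialgebraD(2)[OF bialgebra_of_hopf]

lemmas hopf_lin = hopf_algebraD(2)[OF hopf] hopf_algebraD(2)[OF hopf, THEN clinear_compose]
  coalgebra_linear[OF coalgebra_of_hopf] coalgebra_linear(2)[OF coalgebra_of_hopf, THEN clinear_compose]
  mult_linear[OF algebra_of_hopf]

text \<open>
  Both sides are convolution inverses of the multiplication \<open>A \<otimes> A \<rightarrow> A\<close>.
\<close>

lemma antipode_mult: "antipode A (x \<cdot>\<^bsub>A\<^esub> y) = antipode A y \<cdot>\<^bsub>A\<^esub> antipode A x"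
proof -
  note lin' = lin hopf_lin
  let ?C = "tensor_bialgebra A A"
  let ?m = "tensor_lift (\<lambda>x y. x \<cdot>\<^bsub>A\<^esub> y)"
  let ?s = "tensor_lift (\<lambda>x y. antipode A (x \<cdot>\<^bsub>A\<^esub> y))"
  let ?n = "tensor_lift (\<lambda>x y. antipode A y \<cdot>\<^bsub>A\<^esub> antipode A x)"
  note cA = coalgebra_of_hopf
  have lift: "?m (x \<otimes> y) = x \<cdot>\<^bsub>A\<^esub> y" "?s (x \<otimes> y) = antipode A (x \<cdot>\<^bsub>A\<^esub> y)"
    "?n (x \<otimes> y) = antipode A y \<cdot>\<^bsub>A\<^esub> antipode A x" for x y
    by (rule tensor_lift_pure, (intro lin')[1])+
  have lin_lift: "clinear ?m" "clinear ?s" "clinear ?n"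
    by (rule clinear_tensor_lift, (intro lin')[1])+
  have "?s = ?n"
  proof (rule conv_inverse_unique[OF coalgebra_tensor[OF cA cA] algebra_of_hopf lin_lift(2,1,3)])
    show "conv ?C (mult A) ?m ?n = (\<lambda>c. counit ?C c *\<^sub>C \<one>\<^bsub>A\<^esub>)"
      by (rule conv_inverse_tensor[OF cA cA algebra_of_hopf]; (intro lin')?)
        (rule hopf_algebraD(4)[OF hopf])+
    show "conv ?C (mult A) ?s ?m = (\<lambda>c. counit ?C c *\<^sub>C \<one>\<^bsub>A\<^esub>)"
      unfolding conv_def
    proof (rule ext, rule tensor_linear_eqI)
      fix x y
      have "sweedler ?C (x \<otimes> y) (\<lambda>x y. ?s x \<cdot>\<^bsub>A\<^esub> ?m y) =
        sweedler A x (\<lambda>x1 x2. sweedler A y (\<lambda>y1 y2. antipode A (x1 \<cdot>\<^bsub>A\<^esub> y1) \<cdot>\<^bsub>A\<^esub> (x2 \<cdot>\<^bsub>A\<^esub> y2)))"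
        by (subst sweedler_tensor_pure[OF cA cA], (intro lin')[1]) (simp add: lift)
      also have "\<dots> = sweedler A (x \<cdot>\<^bsub>A\<^esub> y) (\<lambda>z1 z2. antipode A z1 \<cdot>\<^bsub>A\<^esub> z2)"
        by (rule sweedler_mult[OF bialgebra_of_hopf, symmetric]) (intro lin')
      finally show "sweedler ?C (x \<otimes> y) (\<lambda>x y. ?s x \<cdot>\<^bsub>A\<^esub> ?m y) = counit ?C (x \<otimes> y) *\<^sub>C \<one>\<^bsub>A\<^esub>"
        by (simp add: hopf_algebraD(3)[OF hopf] counit_tensor_pure[OF cA cA]
            bialgebraD(3)[OF bialgebra_of_hopf])
    qed (intro lin' clinear_comult_tensor[OF cA cA] clinear_counit_tensor[OF cA cA])+
  qed
  then show ?thesis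
    using lift(2,3)[of x y] by simp
qed

lemma antipode_one: "antipode A \<one>\<^bsub>A\<^esub> = \<one>\<^bsub>A\<^esub>"
proof -
  note lin' = lin hopf_lin
  have "sweedler A \<one>\<^bsub>A\<^esub> (\<lambda>x1 x2. antipode A x1 \<cdot>\<^bsub>A\<^esub> x2) = antipode A \<one>\<^bsub>A\<^esub> \<cdot>\<^bsub>A\<^esub> \<one>\<^bsub>A\<^esub>"
    by (rule sweedler_one[OF bialgebra_of_hopf]) (intro lin')
  then show ?thesis
    by (simp add: hopf_algebraD(3)[OF hopf] bialgebraD[OF bialgebra_of_hopf]
        algebraD[OF algebra_of_hopf] scaleC_one)
qed

lemma counit_antipode: "counit A (antipode A x) = counit A x"
proof -
  note lin' = lin hopf_lin
  have "counit A (sweedler A x (\<lambda>x1 x2. antipode A x1 \<cdot>\<^bsub>A\<^esub> x2)) =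
    sweedler A x (\<lambda>x1 x2. counit A (antipode A x1 \<cdot>\<^bsub>A\<^esub> x2))"
    by (rule sweedler_pull) (intro lin')+
  also have "\<dots> = sweedler A x (\<lambda>x1 x2. counit A x2 *\<^sub>C counit A (antipode A x1))"
    by (simp add: bialgebraD[OF bialgebra_of_hopf] scaleC_complex_def mult.commute)
  also have "\<dots> = counit A (antipode A x)"
    by (rule sweedler_counit_right[OF coalgebra_of_hopf]) (intro lin')
  finally show ?thesis
    by (simp add: hopf_algebraD(3)[OF hopf] clinear_scale[OF coalgebra_linear(2)[OF coalgebra_of_hopf]]
        bialgebraD[OF bialgebra_of_hopf] scaleC_complex_def)
qed

text \<open>
  Applying the antipode, which reverses products, turns these identities into the antipode
  identities.
\<close>

lemma inv_antipode:
  assumes bij: "bij (antipode A)"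
  shows "clinear (inv (antipode A))"
    and "sweedler A x (\<lambda>x1 x2. x2 \<cdot>\<^bsub>A\<^esub> inv (antipode A) x1) = counit A x *\<^sub>C \<one>\<^bsub>A\<^esub>"
    and "sweedler A x (\<lambda>x1 x2. inv (antipode A) x2 \<cdot>\<^bsub>A\<^esub> x1) = counit A x *\<^sub>C \<one>\<^bsub>A\<^esub>"
proof -
  let ?S = "antipode A" and ?T = "inv (antipode A)"
  note S = hopf_algebraD(2)[OF hopf]
  have ST: "?S (?T x) = x" for x
    using bij by (simp add: bij_is_surj surj_f_inv_f)
  have S_eqI: "x = y" if "?S x = ?S y" for x y
    using that bij by (meson bij_is_inj injD)
  show T: "clinear ?T"
    by (rule clinearI; rule S_eqI) (simp_all add: ST clinear_add[OF S] clinear_scale[OF S])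
  note lin' = lin hopf_lin T T[THEN clinear_compose]
  have one: "?S (counit A x *\<^sub>C \<one>\<^bsub>A\<^esub>) = counit A x *\<^sub>C \<one>\<^bsub>A\<^esub>"
    by (simp add: clinear_scale[OF S] antipode_one)
  have "?S (sweedler A x (\<lambda>x1 x2. x2 \<cdot>\<^bsub>A\<^esub> ?T x1)) = sweedler A x (\<lambda>x1 x2. ?S (x2 \<cdot>\<^bsub>A\<^esub> ?T x1))"
    by (rule sweedler_pull) (intro lin')+
  then show "sweedler A x (\<lambda>x1 x2. x2 \<cdot>\<^bsub>A\<^esub> ?T x1) = counit A x *\<^sub>C \<one>\<^bsub>A\<^esub>"
    by - (rule S_eqI, simp add: one antipode_mult ST hopf_algebraD[OF hopf])
  have "?S (sweedler A x (\<lambda>x1 x2. ?T x2 \<cdot>\<^bsub>A\<^esub> x1)) = sweedler A x (\<lambda>x1 x2. ?S (?T x2 \<cdot>\<^bsub>A\<^esub> x1))"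
    by (rule sweedler_pull) (intro lin')+
  then show "sweedler A x (\<lambda>x1 x2. ?T x2 \<cdot>\<^bsub>A\<^esub> x1) = counit A x *\<^sub>C \<one>\<^bsub>A\<^esub>"
    by - (rule S_eqI, simp add: one antipode_mult ST hopf_algebraD[OF hopf])
qed

end

section \<open>The enveloping algebra and adjoint actions\<close>

definition opposite :: "('e :: complex_vector, 'm) alg_scheme \<Rightarrow> 'e alg"
  where "opposite E = \<lparr>mult = (\<lambda>x y. y \<cdot>\<^bsub>E\<^esub> x), unity = \<one>\<^bsub>E\<^esub>\<rparr>"

definition enveloping :: "('e :: complex_vector, 'm) alg_scheme \<Rightarrow> ('e \<otimes> 'e) alg"
  where "enveloping E = tensor_algebra E (opposite E)"

text \<open>
  Bimodules over \<open>E\<close> are modules over the enveloping algebra; this is the regular bimodule.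
\<close>

definition env_act :: "('e :: complex_vector, 'm) alg_scheme \<Rightarrow> 'e \<otimes> 'e \<Rightarrow> 'e \<Rightarrow> 'e"
  where "env_act E t u = tensor_lift (\<lambda>p q. p \<cdot>\<^bsub>E\<^esub> u \<cdot>\<^bsub>E\<^esub> q) t"

text \<open>
  The element of the enveloping algebra through which \<open>a\<close> acts on \<open>E\<close> by the adjoint action
  \<open>u \<mapsto> \<Sum> i a1 \<cdot> u \<cdot> i (S a2)\<close>.
\<close>

definition env_adjoint ::
    "('a :: complex_vector, 'm) hopf_scheme \<Rightarrow> ('a \<Rightarrow> 'e :: complex_vector) \<Rightarrow> 'a \<Rightarrow> 'e \<otimes> 'e"
  where "env_adjoint A i a = sweedler A a (\<lambda>x y. i x \<otimes> i (antipode A y))"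

context
  fixes E :: "('e :: complex_vector, 'm) alg_scheme"
  assumes E: "algebra E"
begin

lemma algebra_opposite: "algebra (opposite E)"
  using E by (auto simp: opposite_def algebra_def cbilinear_def)

lemma algebra_enveloping: "algebra (enveloping E)"
  unfolding enveloping_def by (rule algebra_tensor_algebra[OF E algebra_opposite])

lemma enveloping_mult_pure:
  "(p \<otimes> q) \<cdot>\<^bsub>enveloping E\<^esub> (p' \<otimes> q') = (p \<cdot>\<^bsub>E\<^esub> p') \<otimes> (q' \<cdot>\<^bsub>E\<^esub> q)"
  unfolding enveloping_def
  by (simp add: tensor_algebra_mult_pure[OF E algebra_opposite]) (simp add: opposite_def)

lemma enveloping_one: "\<one>\<^bsub>enveloping E\<^esub> = \<one>\<^bsub>E\<^esub> \<otimes> \<one>\<^bsub>E\<^esub>"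
  by (simp add: enveloping_def tensor_algebra_def opposite_def)

lemma env_act_pure: "env_act E (p \<otimes> q) u = p \<cdot>\<^bsub>E\<^esub> u \<cdot>\<^bsub>E\<^esub> q"
  unfolding env_act_def by (rule tensor_lift_pure) (intro lin mult_linear[OF E])

lemma cbilinear_env_act: "cbilinear (env_act E)"
  unfolding env_act_def by (intro lin mult_linear[OF E])

lemma env_act_mult: "env_act E (s \<cdot>\<^bsub>enveloping E\<^esub> t) u = env_act E s (env_act E t u)"
proof -
  note lin' = lin mult_linear[OF E] mult_linear[OF algebra_enveloping]
    cbilinear_env_act[THEN cbilinear_left] cbilinear_env_act[THEN cbilinear_right]
  show ?thesis
    by (rule tensor_bilinear_eqI[of "\<lambda>s t. env_act E (s \<cdot>\<^bsub>enveloping E\<^esub> t) u"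
          "\<lambda>s t. env_act E s (env_act E t u)"], (intro lin')[1], (intro lin')[1])
      (simp add: enveloping_mult_pure env_act_pure algebraD[OF E])
qed

context
  fixes A :: "('a :: complex_vector, 'n) hopf_scheme" and i :: "'a \<Rightarrow> 'e"
  assumes A: "hopf_algebra A" and i: "clinear i"
    and i_mult: "\<And>x y. i (x \<cdot>\<^bsub>A\<^esub> y) = i x \<cdot>\<^bsub>E\<^esub> i y"
    and i_one: "i \<one>\<^bsub>A\<^esub> = \<one>\<^bsub>E\<^esub>"
begin

text \<open>
  The antipode reverses products, and so does the multiplication of the opposite algebra.
\<close>

lemma env_adjoint_mult:
  "env_adjoint A i (x \<cdot>\<^bsub>A\<^esub> y) = env_adjoint A i x \<cdot>\<^bsub>enveloping E\<^esub> env_adjoint A i y"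
proof -
  let ?T = "enveloping E"
  note lin' = lin hopf_lin[OF A] i i[THEN clinear_compose] mult_linear[OF algebra_enveloping]
  have "env_adjoint A i (x \<cdot>\<^bsub>A\<^esub> y) = sweedler A x (\<lambda>x1 x2. sweedler A y (\<lambda>y1 y2.
      (i x1 \<otimes> i (antipode A x2)) \<cdot>\<^bsub>?T\<^esub> (i y1 \<otimes> i (antipode A y2))))"
    unfolding env_adjoint_def
    by (subst sweedler_mult[OF bialgebra_of_hopf[OF A]], (intro lin')[1])
      (simp add: i_mult antipode_mult[OF A] enveloping_mult_pure)
  also have "\<dots> = sweedler A x (\<lambda>x1 x2. (i x1 \<otimes> i (antipode A x2)) \<cdot>\<^bsub>?T\<^esub> env_adjoint A i y)"
    unfolding env_adjoint_def
    by (subst sweedler_pull[of "\<lambda>t. s \<cdot>\<^bsub>?T\<^esub> t" for s]) (intro lin' refl)+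
  also have "\<dots> = env_adjoint A i x \<cdot>\<^bsub>?T\<^esub> env_adjoint A i y"
    unfolding env_adjoint_def[of A i x]
    by (rule sweedler_pull[symmetric]) (intro lin')+
  finally show ?thesis .
qed

lemma env_adjoint_one: "env_adjoint A i \<one>\<^bsub>A\<^esub> = \<one>\<^bsub>enveloping E\<^esub>"
  unfolding env_adjoint_def
  by (subst sweedler_one[OF bialgebra_of_hopf[OF A]])
    (intro lin hopf_lin[OF A] i[THEN clinear_compose],
     simp add: antipode_one[OF A] i_one enveloping_one)

lemma conv_inverse_antipode:
  "sweedler A a (\<lambda>x y. i x \<cdot>\<^bsub>E\<^esub> i (antipode A y)) = counit A a *\<^sub>C \<one>\<^bsub>E\<^esub>"
  "sweedler A a (\<lambda>x y. i (antipode A x) \<cdot>\<^bsub>E\<^esub> i y) = counit A a *\<^sub>C \<one>\<^bsub>E\<^esub>"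
proof -
  note lin' = lin hopf_lin[OF A]
  show "sweedler A a (\<lambda>x y. i x \<cdot>\<^bsub>E\<^esub> i (antipode A y)) = counit A a *\<^sub>C \<one>\<^bsub>E\<^esub>"
    by (subst i_mult[symmetric], subst sweedler_pull[OF i, symmetric])
      (intro lin', simp add: hopf_algebraD[OF A] clinear_scale[OF i] i_one)
  show "sweedler A a (\<lambda>x y. i (antipode A x) \<cdot>\<^bsub>E\<^esub> i y) = counit A a *\<^sub>C \<one>\<^bsub>E\<^esub>"
    by (subst i_mult[symmetric], subst sweedler_pull[OF i, symmetric])
      (intro lin', simp add: hopf_algebraD[OF A] clinear_scale[OF i] i_one)
qed

end

context
  fixes C :: "('c :: complex_vector, 'n) bialg_scheme" and l r :: "'c \<Rightarrow> 'e"
  assumes C: "coalgebra C" and l: "clinear l" and r: "clinear r"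
begin

lemma env_act_conv: "env_act E (conv C pure_tensor l r c) u = sweedler C c (\<lambda>x y. l x \<cdot>\<^bsub>E\<^esub> u \<cdot>\<^bsub>E\<^esub> r y)"
proof -
  have "clinear (\<lambda>t. env_act E t u)"
    using cbilinear_env_act by (simp add: cbilinear_def)
  from conv_pull[OF this cbilinear_pure_tensor l r] show ?thesis
    by (simp add: env_act_pure conv_def)
qed

text \<open>
  In \<open>\<Sum> (l c1 \<cdot> u \<cdot> r c2) \<cdot> (l c3 \<cdot> v \<cdot> r c4)\<close> the two middle factors cancel because \<open>r\<close> is a left
  convolution inverse of \<open>l\<close>.
\<close>

lemma adjoint_act_mult:
  assumes rl: "conv C (mult E) r l = (\<lambda>c. counit C c *\<^sub>C \<one>\<^bsub>E\<^esub>)"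
  defines "ad \<equiv> \<lambda>c. env_act E (conv C pure_tensor l r c)"
  shows "ad c (u \<cdot>\<^bsub>E\<^esub> v) = sweedler C c (\<lambda>c1 c2. ad c1 u \<cdot>\<^bsub>E\<^esub> ad c2 v)"
proof -
  let ?m = "conv C (mult E)"
  note bil = algebraD(1)[OF E]
  have lu: "clinear (\<lambda>c. l c \<cdot>\<^bsub>E\<^esub> u)" and vr: "clinear (\<lambda>c. v \<cdot>\<^bsub>E\<^esub> r c)"
    by (intro lin mult_linear[OF E] l r)+
  note assoc = conv_assoc[OF C bil bil bil bil]
  have "?m (?m (\<lambda>c. l c \<cdot>\<^bsub>E\<^esub> u) r) (?m l (\<lambda>c. v \<cdot>\<^bsub>E\<^esub> r c)) =
    ?m (\<lambda>c. l c \<cdot>\<^bsub>E\<^esub> u) (?m r (?m l (\<lambda>c. v \<cdot>\<^bsub>E\<^esub> r c)))"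
    by (intro assoc lu r l vr clinear_conv C bil) (simp add: algebraD[OF E])
  also have "?m r (?m l (\<lambda>c. v \<cdot>\<^bsub>E\<^esub> r c)) = ?m (?m r l) (\<lambda>c. v \<cdot>\<^bsub>E\<^esub> r c)"
    by (intro assoc[symmetric] lu r l vr) (simp add: algebraD[OF E])
  also have "\<dots> = (\<lambda>c. v \<cdot>\<^bsub>E\<^esub> r c)"
    unfolding rl by (rule ext) (simp add: conv_counit_left[OF C vr bil] algebraD[OF E])
  finally show ?thesis
    unfolding ad_def env_act_conv
    by (simp add: conv_def algebraD[OF E] fun_eq_iff)
qed

lemma adjoint_act_one:
  assumes lr: "conv C (mult E) l r = (\<lambda>c. counit C c *\<^sub>C \<one>\<^bsub>E\<^esub>)"
  shows "env_act E (conv C pure_tensor l r c) \<one>\<^bsub>E\<^esub> = counit C c *\<^sub>C \<one>\<^bsub>E\<^esub>"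
  unfolding env_act_conv using fun_cong[OF lr, of c] by (simp add: conv_def algebraD[OF E])

end

end

lemma conv_scaleC_pull:
  assumes G: "clinear G" and fg: "clinear f" "clinear g"
  shows "G (conv C scaleC f g c) = conv C scaleC f (\<lambda>c. G (g c)) c"
    and "G (conv C (\<lambda>x r. r *\<^sub>C x) g f c) = conv C (\<lambda>x r. r *\<^sub>C x) (\<lambda>c. G (g c)) f c"
  by (subst conv_pull[OF G _ fg] conv_pull[OF G _ fg(2,1)],
      (intro lin)[1], simp add: clinear_scale[OF G] conv_def)+

section \<open>The Heisenberg double\<close>

locale hopf_pair =
  fixes A :: "('a :: complex_vector) hopf" and B :: "('b :: complex_vector) hopf"
    and \<phi> :: "'a \<Rightarrow> 'b \<Rightarrow> complex"
  assumes hopf_A: "hopf_algebra A" and bij_antipode_A: "bij (antipode A)"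
    and hopf_B: "hopf_algebra B" and pairing: "hopf_pairing A B \<phi>"
begin

lemma
  shows cbilinear_pairing: "cbilinear \<phi>"
    and pairing_mult_right: "\<phi> a (b \<cdot>\<^bsub>B\<^esub> b') = sweedler A a (\<lambda>a1 a2. \<phi> a1 b * \<phi> a2 b')"
    and pairing_mult_left: "\<phi> (a \<cdot>\<^bsub>A\<^esub> a') b = sweedler B b (\<lambda>b1 b2. \<phi> a b2 * \<phi> a' b1)"
    and pairing_one_right: "\<phi> a \<one>\<^bsub>B\<^esub> = counit A a"
    and pairing_one_left: "\<phi> \<one>\<^bsub>A\<^esub> b = counit B b"
  using pairing unfolding hopf_pairing_def by blast+

lemmas bialg_A = bialgebra_of_hopf[OF hopf_A] and bialg_B = bialgebra_of_hopf[OF hopf_B]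
lemmas alg_A = algebra_of_hopf[OF hopf_A] and alg_B = algebra_of_hopf[OF hopf_B]
lemmas coalg_A = coalgebra_of_hopf[OF hopf_A] and coalg_B = coalgebra_of_hopf[OF hopf_B]

lemmas plin = lin hopf_lin[OF hopf_A] hopf_lin[OF hopf_B]
  inv_antipode(1)[OF hopf_A bij_antipode_A] inv_antipode(1)[OF hopf_A bij_antipode_A, THEN clinear_compose]
  cbilinear_left[OF cbilinear_pairing] cbilinear_right[OF cbilinear_pairing]

lemmas AB_simps = algebraD[OF alg_A] algebraD[OF alg_B] mult_scaleC[OF alg_A] mult_scaleC[OF alg_B]

lemma pure_tensor_scaleC: "(c *\<^sub>C x) \<otimes> y = c *\<^sub>C (x \<otimes> y)" "x \<otimes> (c *\<^sub>C y) = c *\<^sub>C (x \<otimes> y)"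
  for x :: "'u :: complex_vector" and y :: "'v :: complex_vector"
  by (rule cbilinear_scale[OF cbilinear_pure_tensor])+

text \<open>
  The left action \<open>a \<rightharpoonup> y = \<Sum> \<phi>(a, y1) y2\<close> of \<open>A\<close> on \<open>B\<close>. It makes \<open>B\<close> an \<open>A\<close>-module algebra, and the
  Heisenberg double is the corresponding smash product; its associativity is proved in this form.
\<close>

definition pair_act_B :: "'a \<Rightarrow> 'b \<Rightarrow> 'b"
  where "pair_act_B a y = sweedler B y (\<lambda>y1 y2. \<phi> a y1 *\<^sub>C y2)"

lemma cbilinear_pair_act_B: "cbilinear pair_act_B"
  unfolding pair_act_B_def by (intro plin)

lemmas rlin = plin cbilinear_left[OF cbilinear_pair_act_B] cbilinear_right[OF cbilinear_pair_act_B]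

lemma pair_act_B_one: "pair_act_B \<one>\<^bsub>A\<^esub> y = y"
  unfolding pair_act_B_def pairing_one_left by (rule sweedler_counit_left[OF coalg_B]) (intro lin)

lemma pair_act_B_unit: "pair_act_B a \<one>\<^bsub>B\<^esub> = counit A a *\<^sub>C \<one>\<^bsub>B\<^esub>"
  unfolding pair_act_B_def by (subst sweedler_one[OF bialg_B]; (intro plin)?) (simp add: pairing_one_right)

lemma pair_act_B_mult: "pair_act_B (a \<cdot>\<^bsub>A\<^esub> a') y = pair_act_B a (pair_act_B a' y)"
proof -
  have "pair_act_B (a \<cdot>\<^bsub>A\<^esub> a') y = sweedler B y (\<lambda>u y3. sweedler B u (\<lambda>y1 y2. (\<phi> a y2 * \<phi> a' y1) *\<^sub>C y3))"
    unfolding pair_act_B_def pairing_mult_left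
    by (rule sweedler_cong, rule sweedler_pull[of "\<lambda>r. r *\<^sub>C z" for z]) (intro plin)+
  also have "\<dots> = sweedler B y (\<lambda>y1 v. sweedler B v (\<lambda>y2 y3. (\<phi> a y2 * \<phi> a' y1) *\<^sub>C y3))"
    by (rule sweedler_coassoc[OF coalg_B]) (intro plin)+
  also have "\<dots> = sweedler B y (\<lambda>y1 v. \<phi> a' y1 *\<^sub>C pair_act_B a v)"
    unfolding pair_act_B_def
    by (subst sweedler_pull[of "\<lambda>z. r *\<^sub>C z" for r]; (intro plin)?) (simp add: scaleC_scaleC mult.commute)
  also have "\<dots> = pair_act_B a (pair_act_B a' y)"
    unfolding pair_act_B_def[of a']
    by (subst sweedler_pull[of "pair_act_B a"]; (intro rlin)?) (simp add: cbilinear_scale[OF cbilinear_pair_act_B])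
  finally show ?thesis .
qed

lemma pair_act_B_prod: "pair_act_B a (y \<cdot>\<^bsub>B\<^esub> y') = sweedler A a (\<lambda>a1 a2. pair_act_B a1 y \<cdot>\<^bsub>B\<^esub> pair_act_B a2 y')"
proof -
  have "pair_act_B a (y \<cdot>\<^bsub>B\<^esub> y') = sweedler B y (\<lambda>y1 y2. sweedler B y' (\<lambda>z1 z2.
      sweedler A a (\<lambda>a1 a2. (\<phi> a1 y1 * \<phi> a2 z1) *\<^sub>C (y2 \<cdot>\<^bsub>B\<^esub> z2))))"
    unfolding pair_act_B_def
    by (subst sweedler_mult[OF bialg_B], (intro plin)[1], unfold pairing_mult_right,
        subst sweedler_pull[of "\<lambda>r. r *\<^sub>C z" for z]) (intro plin refl)+
  also have "\<dots> = sweedler B y (\<lambda>y1 y2. sweedler A a (\<lambda>a1 a2. sweedler B y' (\<lambda>z1 z2.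
      (\<phi> a1 y1 * \<phi> a2 z1) *\<^sub>C (y2 \<cdot>\<^bsub>B\<^esub> z2))))"
    by (subst sweedler_commute[of _ B _ A]) (intro plin refl)+
  also have "\<dots> = sweedler A a (\<lambda>a1 a2. sweedler B y (\<lambda>y1 y2. sweedler B y' (\<lambda>z1 z2.
      (\<phi> a1 y1 * \<phi> a2 z1) *\<^sub>C (y2 \<cdot>\<^bsub>B\<^esub> z2))))"
    by (rule sweedler_commute) (intro plin)+
  also have "\<dots> = sweedler A a (\<lambda>a1 a2. sweedler B y (\<lambda>y1 y2. (\<phi> a1 y1 *\<^sub>C y2) \<cdot>\<^bsub>B\<^esub> pair_act_B a2 y'))"
    unfolding pair_act_B_def
    by (subst sweedler_pull[of "\<lambda>z. (r *\<^sub>C w) \<cdot>\<^bsub>B\<^esub> z" for r w]; (intro plin)?) (simp add: AB_simps scaleC_scaleC mult.commute)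
  also have "\<dots> = sweedler A a (\<lambda>a1 a2. pair_act_B a1 y \<cdot>\<^bsub>B\<^esub> pair_act_B a2 y')"
    unfolding pair_act_B_def[of _ y]
    by (subst sweedler_pull[of "\<lambda>z. z \<cdot>\<^bsub>B\<^esub> w" for w]) (intro rlin refl)+
  finally show ?thesis .
qed

abbreviation "H \<equiv> heisenberg_double A B \<phi>"

lemma heisenberg_mult_pure:
  "(b \<otimes> a) \<cdot>\<^bsub>H\<^esub> (b' \<otimes> a') = sweedler A a (\<lambda>a1 a2. (b \<cdot>\<^bsub>B\<^esub> pair_act_B a1 b') \<otimes> (a2 \<cdot>\<^bsub>A\<^esub> a'))"
proof -
  have "(b \<otimes> a) \<cdot>\<^bsub>H\<^esub> (b' \<otimes> a') = sweedler A a (\<lambda>a1 a2. sweedler B b' (\<lambda>b1 b2.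
      \<phi> a1 b1 *\<^sub>C ((b \<cdot>\<^bsub>B\<^esub> b2) \<otimes> (a2 \<cdot>\<^bsub>A\<^esub> a'))))"
    unfolding heisenberg_double_def alg.simps
    by (rule tensor_lift_tensor_lift) (intro plin)+
  also have "\<dots> = sweedler A a (\<lambda>a1 a2. (b \<cdot>\<^bsub>B\<^esub> pair_act_B a1 b') \<otimes> (a2 \<cdot>\<^bsub>A\<^esub> a'))"
    unfolding pair_act_B_def
    by (subst sweedler_pull[of "\<lambda>z. (b \<cdot>\<^bsub>B\<^esub> z) \<otimes> w" for w]; (intro plin)?) (simp add: AB_simps pure_tensor_scaleC)
  finally show ?thesis .
qed

lemma cbilinear_heisenberg_mult: "cbilinear (mult H)"
  unfolding heisenberg_double_def alg.simps
  by (rule tensor_lift_tensor_lift(1)) (intro plin)+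

lemma heisenberg_one: "\<one>\<^bsub>H\<^esub> = \<one>\<^bsub>B\<^esub> \<otimes> \<one>\<^bsub>A\<^esub>"
  by (simp add: heisenberg_double_def)

lemma heisenberg_mult_B: "(b \<otimes> \<one>\<^bsub>A\<^esub>) \<cdot>\<^bsub>H\<^esub> (b' \<otimes> a') = (b \<cdot>\<^bsub>B\<^esub> b') \<otimes> a'"
  unfolding heisenberg_mult_pure
  by (subst sweedler_one[OF bialg_A]; (intro rlin)?) (simp add: pair_act_B_one AB_simps)

lemma heisenberg_mult_A: "(b \<otimes> a) \<cdot>\<^bsub>H\<^esub> (\<one>\<^bsub>B\<^esub> \<otimes> a') = b \<otimes> (a \<cdot>\<^bsub>A\<^esub> a')"
  unfolding heisenberg_mult_pure
  by (simp add: pair_act_B_unit AB_simps pure_tensor_scaleC)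
    (rule sweedler_counit_left[OF coalg_A], intro rlin)

text \<open>
  Both sides are \<open>\<Sum> b (a1 \<rightharpoonup> b') (a2 a'1 \<rightharpoonup> b'') \<sharp> a3 a'2 a''\<close>: the left one since
  comultiplication is multiplicative, the right one since the action respects products of \<open>B\<close>.
\<close>

lemma heisenberg_assoc_pure:
  "((b \<otimes> a) \<cdot>\<^bsub>H\<^esub> (b' \<otimes> a')) \<cdot>\<^bsub>H\<^esub> (b'' \<otimes> a'') = (b \<otimes> a) \<cdot>\<^bsub>H\<^esub> ((b' \<otimes> a') \<cdot>\<^bsub>H\<^esub> (b'' \<otimes> a''))"
proof -
  note lin' = rlin cbilinear_left[OF cbilinear_heisenberg_mult] cbilinear_right[OF cbilinear_heisenberg_mult]
  let ?F = "\<lambda>a1 a2 a3 c1 c2. (b \<cdot>\<^bsub>B\<^esub> (pair_act_B a1 b' \<cdot>\<^bsub>B\<^esub> pair_act_B a2 (pair_act_B c1 b''))) \<otimes> (a3 \<cdot>\<^bsub>A\<^esub> (c2 \<cdot>\<^bsub>A\<^esub> a''))"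
  have "((b \<otimes> a) \<cdot>\<^bsub>H\<^esub> (b' \<otimes> a')) \<cdot>\<^bsub>H\<^esub> (b'' \<otimes> a'') =
    sweedler A a (\<lambda>a1 u. ((b \<cdot>\<^bsub>B\<^esub> pair_act_B a1 b') \<otimes> (u \<cdot>\<^bsub>A\<^esub> a')) \<cdot>\<^bsub>H\<^esub> (b'' \<otimes> a''))"
    unfolding heisenberg_mult_pure[of b a]
    by (rule sweedler_pull[of "\<lambda>t. t \<cdot>\<^bsub>H\<^esub> w" for w]) (intro lin')+
  also have "\<dots> = sweedler A a (\<lambda>a1 u. sweedler A u (\<lambda>a2 a3. sweedler A a' (\<lambda>c1 c2. ?F a1 a2 a3 c1 c2)))"
    unfolding heisenberg_mult_pure
    by (subst sweedler_mult[OF bialg_A]) (intro lin', simp add: AB_simps pair_act_B_mult)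
  also have "\<dots> = sweedler A a (\<lambda>p a3. sweedler A p (\<lambda>a1 a2. sweedler A a' (\<lambda>c1 c2. ?F a1 a2 a3 c1 c2)))"
    by (rule sweedler_coassoc[OF coalg_A, symmetric]) (intro lin')+
  also have "\<dots> = sweedler A a (\<lambda>p a3. sweedler A a' (\<lambda>c1 c2. sweedler A p (\<lambda>a1 a2. ?F a1 a2 a3 c1 c2)))"
    by (subst sweedler_commute) (intro lin' refl)+
  also have "\<dots> = sweedler A a' (\<lambda>c1 c2. sweedler A a (\<lambda>p a3. sweedler A p (\<lambda>a1 a2. ?F a1 a2 a3 c1 c2)))"
    by (rule sweedler_commute) (intro lin')+
  also have "\<dots> = sweedler A a' (\<lambda>c1 c2. (b \<otimes> a) \<cdot>\<^bsub>H\<^esub> ((b' \<cdot>\<^bsub>B\<^esub> pair_act_B c1 b'') \<otimes> (c2 \<cdot>\<^bsub>A\<^esub> a'')))"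
    unfolding heisenberg_mult_pure pair_act_B_prod
    by (subst sweedler_pull[of "\<lambda>z. (b \<cdot>\<^bsub>B\<^esub> z) \<otimes> w" for w]) (intro lin' refl)+
  also have "\<dots> = (b \<otimes> a) \<cdot>\<^bsub>H\<^esub> ((b' \<otimes> a') \<cdot>\<^bsub>H\<^esub> (b'' \<otimes> a''))"
    unfolding heisenberg_mult_pure[of b']
    by (rule sweedler_pull[symmetric]) (intro lin')+
  finally show ?thesis .
qed

lemma algebra_heisenberg: "algebra H"
proof -
  note lin' = rlin cbilinear_left[OF cbilinear_heisenberg_mult] cbilinear_right[OF cbilinear_heisenberg_mult]
  have "(s \<cdot>\<^bsub>H\<^esub> t) \<cdot>\<^bsub>H\<^esub> r = s \<cdot>\<^bsub>H\<^esub> (t \<cdot>\<^bsub>H\<^esub> r)" for s t r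
  proof (rule tensor_bilinear_eqI[of "\<lambda>s t. (s \<cdot>\<^bsub>H\<^esub> t) \<cdot>\<^bsub>H\<^esub> r" "\<lambda>s t. s \<cdot>\<^bsub>H\<^esub> (t \<cdot>\<^bsub>H\<^esub> r)"])
    show "cbilinear (\<lambda>s t. (s \<cdot>\<^bsub>H\<^esub> t) \<cdot>\<^bsub>H\<^esub> r)" "cbilinear (\<lambda>s t. s \<cdot>\<^bsub>H\<^esub> (t \<cdot>\<^bsub>H\<^esub> r))"
      by (intro lin')+
    show "((x \<otimes> y) \<cdot>\<^bsub>H\<^esub> (u \<otimes> v)) \<cdot>\<^bsub>H\<^esub> r = (x \<otimes> y) \<cdot>\<^bsub>H\<^esub> ((u \<otimes> v) \<cdot>\<^bsub>H\<^esub> r)" for x y u v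
      by (rule tensor_linear_eqI[of _ _ r], (intro lin')[1], (intro lin')[1], rule heisenberg_assoc_pure)
  qed
  moreover have "\<one>\<^bsub>H\<^esub> \<cdot>\<^bsub>H\<^esub> s = s" for s
    by (rule tensor_linear_eqI[of _ _ s], (intro lin')[1], (intro lin')[1])
      (simp add: heisenberg_one heisenberg_mult_B AB_simps)
  moreover have "s \<cdot>\<^bsub>H\<^esub> \<one>\<^bsub>H\<^esub> = s" for s
    by (rule tensor_linear_eqI[of _ _ s], (intro lin')[1], (intro lin')[1])
      (simp add: heisenberg_one heisenberg_mult_A AB_simps)
  ultimately show ?thesis
    using cbilinear_heisenberg_mult by (simp add: algebra_def)
qed

definition "emb_A a = \<one>\<^bsub>B\<^esub> \<otimes> a"
definition "emb_B b = b \<otimes> \<one>\<^bsub>A\<^esub>"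

lemma clinear_emb: "clinear emb_A" "clinear emb_B"
  unfolding emb_A_def emb_B_def by (intro lin)+

lemma emb_A_mult: "emb_A (x \<cdot>\<^bsub>A\<^esub> y) = emb_A x \<cdot>\<^bsub>H\<^esub> emb_A y"
  by (simp add: emb_A_def heisenberg_mult_A)

lemma emb_B_mult: "emb_B (x \<cdot>\<^bsub>B\<^esub> y) = emb_B x \<cdot>\<^bsub>H\<^esub> emb_B y"
  by (simp add: emb_B_def heisenberg_mult_B)

lemma emb_one: "emb_A \<one>\<^bsub>A\<^esub> = \<one>\<^bsub>H\<^esub>" "emb_B \<one>\<^bsub>B\<^esub> = \<one>\<^bsub>H\<^esub>"
  by (simp_all add: emb_A_def emb_B_def heisenberg_one)

lemma emb_B_emb_A: "emb_B b \<cdot>\<^bsub>H\<^esub> emb_A a = b \<otimes> a"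
  by (simp add: emb_A_def emb_B_def heisenberg_mult_B AB_simps)

lemma emb_A_emb_B: "emb_A a \<cdot>\<^bsub>H\<^esub> emb_B b = sweedler A a (\<lambda>a1 a2. pair_act_B a1 b \<otimes> a2)"
  by (simp add: emb_A_def emb_B_def heisenberg_mult_pure AB_simps)

lemmas elin = rlin mult_linear[OF algebra_heisenberg] clinear_emb clinear_emb[THEN clinear_compose]

section \<open>The pairing as a convolution invertible functional\<close>

abbreviation "C \<equiv> tensor_bialgebra A B"

lemmas coalg_C = coalgebra_tensor[OF coalg_A coalg_B]

text \<open>
  Regarding the pairing as a functional on the coalgebra \<open>A \<otimes> B\<close> turns the Sweedler sums over both
  algebras into convolutions over a single coalgebra. The functional \<open>\<Psi>\<close> is the convolution inverse
  of \<open>\<Phi>\<close>.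
\<close>

definition "\<Phi> = tensor_lift \<phi>"
definition "\<Psi> = tensor_lift (\<lambda>a b. \<phi> (inv (antipode A) a) b)"

lemma
  shows \<Phi>_pure: "\<Phi> (a \<otimes> b) = \<phi> a b" and clinear_\<Phi>: "clinear \<Phi>"
    and \<Psi>_pure: "\<Psi> (a \<otimes> b) = \<phi> (inv (antipode A) a) b" and clinear_\<Psi>: "clinear \<Psi>"
  unfolding \<Phi>_def \<Psi>_def
  by (intro tensor_lift_pure clinear_tensor_lift cbilinear_pairing plin)+

lemmas clin = elin clinear_\<Phi> clinear_\<Phi>[THEN clinear_compose] clinear_\<Psi> clinear_\<Psi>[THEN clinear_compose]
  coalgebra_linear[OF coalg_C] coalgebra_linear(2)[OF coalg_C, THEN clinear_compose]

lemmas counit_C_pure = counit_tensor_pure[OF coalg_A coalg_B]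
lemmas sweedler_C_pure = sweedler_tensor_pure[OF coalg_A coalg_B]

lemma
  shows \<Phi>_\<Psi>: "conv C scaleC \<Phi> \<Psi> = counit C" and \<Psi>_\<Phi>: "conv C scaleC \<Psi> \<Phi> = counit C"
proof -
  let ?T = "inv (antipode A)"
  have pull: "sweedler A a (\<lambda>a1 a2. \<phi> (m a1 a2) b) = counit A a * counit B b"
    if m: "cbilinear m" and eq: "sweedler A a m = counit A a *\<^sub>C \<one>\<^bsub>A\<^esub>" for a b and m
  proof -
    have "clinear (\<lambda>a. \<phi> a b)"
      by (intro plin)
    from sweedler_pull[OF this m, of A a] clinear_scale[OF this] show ?thesis
      by (simp add: eq pairing_one_left scaleC_complex_def)
  qed
  show "conv C scaleC \<Phi> \<Psi> = counit C"
    unfolding conv_def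
  proof (rule ext, rule tensor_linear_eqI)
    fix a b
    have "sweedler C (a \<otimes> b) (\<lambda>x y. \<Phi> x *\<^sub>C \<Psi> y) =
      sweedler A a (\<lambda>a1 a2. sweedler B b (\<lambda>b1 b2. \<phi> (?T a2) b2 * \<phi> a1 b1))"
      by (subst sweedler_C_pure, (intro clin)[1]) (simp add: \<Phi>_pure \<Psi>_pure scaleC_complex_def mult.commute)
    also have "\<dots> = counit C (a \<otimes> b)"
      unfolding pairing_mult_left[symmetric] counit_C_pure
      by (rule pull) (intro clin, rule inv_antipode(3)[OF hopf_A bij_antipode_A])
    finally show "sweedler C (a \<otimes> b) (\<lambda>x y. \<Phi> x *\<^sub>C \<Psi> y) = counit C (a \<otimes> b)" .
  qed (intro clin)+
  show "conv C scaleC \<Psi> \<Phi> = counit C"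
    unfolding conv_def
  proof (rule ext, rule tensor_linear_eqI)
    fix a b
    have "sweedler C (a \<otimes> b) (\<lambda>x y. \<Psi> x *\<^sub>C \<Phi> y) =
      sweedler A a (\<lambda>a1 a2. sweedler B b (\<lambda>b1 b2. \<phi> a2 b2 * \<phi> (?T a1) b1))"
      by (subst sweedler_C_pure, (intro clin)[1]) (simp add: \<Phi>_pure \<Psi>_pure scaleC_complex_def mult.commute)
    also have "\<dots> = counit C (a \<otimes> b)"
      unfolding pairing_mult_left[symmetric] counit_C_pure
      by (rule pull) (intro clin, rule inv_antipode(2)[OF hopf_A bij_antipode_A])
    finally show "sweedler C (a \<otimes> b) (\<lambda>x y. \<Psi> x *\<^sub>C \<Phi> y) = counit C (a \<otimes> b)" .
  qed (intro clin)+
qed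

lemma conv_scaleC_assoc:
  fixes f g :: "'a \<otimes> 'b \<Rightarrow> complex" and h :: "'a \<otimes> 'b \<Rightarrow> 'v :: complex_vector"
  assumes "clinear f" "clinear g" "clinear h"
  shows "conv C scaleC f (conv C scaleC g h) = conv C scaleC (conv C scaleC f g) h"
  by (rule conv_assoc[symmetric, OF coalg_C cbilinear_scaleC cbilinear_scaleC cbilinear_scaleC cbilinear_scaleC assms])
    (simp add: scaleC_scaleC scaleC_complex_def)

lemma conv_scaleC_cancel:
  assumes "clinear h"
  shows "conv C scaleC \<Phi> (conv C scaleC \<Psi> h) = h" "conv C scaleC \<Psi> (conv C scaleC \<Phi> h) = h"
  by (simp_all add: conv_scaleC_assoc clinear_\<Phi> clinear_\<Psi> assms \<Phi>_\<Psi> \<Psi>_\<Phi> conv_counit_scaleC[OF coalg_C assms])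

text \<open>
  Both sides are convolution inverse to the pairing: the left one because the pairing is
  multiplicative (in reversed order) in its first argument, the right one because it is
  multiplicative in its second argument.
\<close>

lemma pairing_antipode: "\<phi> (inv (antipode A) a) b = \<phi> a (antipode B b)"
proof -
  let ?P = "tensor_lift (\<lambda>a b. \<phi> a (antipode B b))"
  have P_pure: "?P (a \<otimes> b) = \<phi> a (antipode B b)" for a b
    by (rule tensor_lift_pure) (intro plin)
  have P: "clinear ?P"
    by (rule clinear_tensor_lift) (intro plin)
  note lin' = clin P P[THEN clinear_compose]
  have "conv C scaleC \<Phi> ?P = counit C"
    unfolding conv_def
  proof (rule ext, rule tensor_linear_eqI)
    fix a b
    have "sweedler C (a \<otimes> b) (\<lambda>x y. \<Phi> x *\<^sub>C ?P y) =
      sweedler A a (\<lambda>a1 a2. sweedler B b (\<lambda>b1 b2. \<phi> a1 b1 * \<phi> a2 (antipode B b2)))"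
      by (subst sweedler_C_pure, (intro lin')[1]) (simp add: \<Phi>_pure P_pure scaleC_complex_def)
    also have "\<dots> = sweedler B b (\<lambda>b1 b2. sweedler A a (\<lambda>a1 a2. \<phi> a1 b1 * \<phi> a2 (antipode B b2)))"
      by (rule sweedler_commute) (intro lin')+
    also have "\<dots> = \<phi> a (sweedler B b (\<lambda>b1 b2. b1 \<cdot>\<^bsub>B\<^esub> antipode B b2))"
      unfolding pairing_mult_right[symmetric] by (rule sweedler_pull[symmetric]) (intro lin')+
    finally show "sweedler C (a \<otimes> b) (\<lambda>x y. \<Phi> x *\<^sub>C ?P y) = counit C (a \<otimes> b)"
      by (simp add: hopf_algebraD[OF hopf_B] counit_C_pure cbilinear_scale[OF cbilinear_pairing]
          pairing_one_right scaleC_complex_def)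
  qed (intro lin')+
  then have "conv C scaleC \<Psi> (conv C scaleC \<Phi> ?P) = conv C scaleC \<Psi> (conv C scaleC \<Phi> \<Psi>)"
    by (simp add: \<Phi>_\<Psi>)
  then have "?P = \<Psi>"
    by (simp add: conv_scaleC_cancel P clinear_\<Psi>)
  then show ?thesis
    using P_pure \<Psi>_pure by metis
qed

text \<open>
  Scalar factors at the two ends of a convolution can be collected outside. They cannot pass each
  other or the factors between them, as the coalgebra is in general not cocommutative.
\<close>

lemma conv_conjugate:
  fixes f :: "'a \<otimes> 'b \<Rightarrow> 'u :: complex_vector" and g :: "'a \<otimes> 'b \<Rightarrow> 'v :: complex_vector"
    and \<beta> :: "'u \<Rightarrow> 'v \<Rightarrow> 'w :: complex_vector"
  assumes \<beta>: "cbilinear \<beta>" and f: "clinear f" and g: "clinear g"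
  shows "conv C \<beta> (conv C scaleC \<Psi> f) (conv C (\<lambda>x r. r *\<^sub>C x) g \<Phi>) =
    conv C (\<lambda>x r. r *\<^sub>C x) (conv C scaleC \<Psi> (conv C \<beta> f g)) \<Phi>"
proof -
  have rs: "cbilinear (\<lambda>(x :: 'x :: complex_vector) r. r *\<^sub>C x)"
    by (intro lin)
  note bil = \<beta> rs cbilinear_scaleC
  note lins = f g clinear_\<Phi> clinear_\<Psi> clinear_conv[OF coalg_C] bil
  have \<beta>_scale: "\<beta> (r *\<^sub>C x) y = r *\<^sub>C \<beta> x y" "\<beta> x (r *\<^sub>C y) = r *\<^sub>C \<beta> x y" for r x y
    by (rule cbilinear_scale[OF \<beta>])+
  have "conv C \<beta> (conv C scaleC \<Psi> f) (conv C (\<lambda>x r. r *\<^sub>C x) g \<Phi>) =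
    conv C scaleC \<Psi> (conv C \<beta> f (conv C (\<lambda>x r. r *\<^sub>C x) g \<Phi>))"
    by (rule conv_assoc[OF coalg_C]; (intro lins)?) (simp add: \<beta>_scale)
  also have "conv C \<beta> f (conv C (\<lambda>x r. r *\<^sub>C x) g \<Phi>) = conv C (\<lambda>x r. r *\<^sub>C x) (conv C \<beta> f g) \<Phi>"
    by (rule conv_assoc[OF coalg_C, symmetric]; (intro lins)?) (simp add: \<beta>_scale)
  also have "conv C scaleC \<Psi> \<dots> = conv C (\<lambda>x r. r *\<^sub>C x) (conv C scaleC \<Psi> (conv C \<beta> f g)) \<Phi>"
    by (rule conv_assoc[OF coalg_C, symmetric]; (intro lins)?) (simp add: scaleC_scaleC mult.commute)
  finally show ?thesis .
qed

section \<open>Products of the two embeddings\<close>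

text \<open>
  The two orders of multiplying the images of \<open>a\<close> and \<open>b\<close> in the Heisenberg double, and the
  candidates for the convolution inverses of these products, which are built from the antipodes.
\<close>

definition "prod_AB = tensor_lift (\<lambda>a b. emb_A a \<cdot>\<^bsub>H\<^esub> emb_B b)"
definition "prod_BA = tensor_lift (\<lambda>a b. emb_B b \<cdot>\<^bsub>H\<^esub> emb_A a)"
definition "antipode_BA = tensor_lift (\<lambda>a b. emb_B (antipode B b) \<cdot>\<^bsub>H\<^esub> emb_A (antipode A a))"
definition "antipode_AB = tensor_lift (\<lambda>a b. emb_A (antipode A a) \<cdot>\<^bsub>H\<^esub> emb_B (antipode B b))"

lemma
  shows prod_AB_pure: "prod_AB (a \<otimes> b) = emb_A a \<cdot>\<^bsub>H\<^esub> emb_B b"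
    and prod_BA_pure: "prod_BA (a \<otimes> b) = emb_B b \<cdot>\<^bsub>H\<^esub> emb_A a"
    and antipode_BA_pure: "antipode_BA (a \<otimes> b) = emb_B (antipode B b) \<cdot>\<^bsub>H\<^esub> emb_A (antipode A a)"
    and antipode_AB_pure: "antipode_AB (a \<otimes> b) = emb_A (antipode A a) \<cdot>\<^bsub>H\<^esub> emb_B (antipode B b)"
  unfolding prod_AB_def prod_BA_def antipode_BA_def antipode_AB_def
  by (rule tensor_lift_pure, (intro clin)[1])+

lemma clinear_prods: "clinear prod_AB" "clinear prod_BA" "clinear antipode_BA" "clinear antipode_AB"
  unfolding prod_AB_def prod_BA_def antipode_BA_def antipode_AB_def
  by (rule clinear_tensor_lift, (intro clin)[1])+

lemmas dlin = clin clinear_prods clinear_prods[THEN clinear_compose]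
lemmas H_simps = algebraD[OF algebra_heisenberg] mult_scaleC[OF algebra_heisenberg]
lemmas H_bil = algebraD(1)[OF algebra_heisenberg]

lemmas antipode_inverse_A =
  conv_inverse_antipode[OF algebra_heisenberg hopf_A clinear_emb(1) emb_A_mult emb_one(1)]
lemmas antipode_inverse_B =
  conv_inverse_antipode[OF algebra_heisenberg hopf_B clinear_emb(2) emb_B_mult emb_one(2)]

lemma prod_AB_antipode_BA: "conv C (mult H) prod_AB antipode_BA = (\<lambda>c. counit C c *\<^sub>C \<one>\<^bsub>H\<^esub>)"
  unfolding prod_AB_def antipode_BA_def
  by (rule conv_inverse_tensor[OF coalg_A coalg_B algebra_heisenberg _ _ _ _
        antipode_inverse_A(1) antipode_inverse_B(1)]) (intro clin)+

lemma antipode_BA_prod_AB: "conv C (mult H) antipode_BA prod_AB = (\<lambda>c. counit C c *\<^sub>C \<one>\<^bsub>H\<^esub>)"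
  unfolding prod_AB_def antipode_BA_def
  by (rule conv_inverse_tensor_flip[OF coalg_A coalg_B algebra_heisenberg _ _ _ _
        antipode_inverse_A(2) antipode_inverse_B(2)]) (intro clin)+

lemma prod_BA_antipode_AB: "conv C (mult H) prod_BA antipode_AB = (\<lambda>c. counit C c *\<^sub>C \<one>\<^bsub>H\<^esub>)"
  unfolding prod_BA_def antipode_AB_def
  by (rule conv_inverse_tensor_flip[OF coalg_A coalg_B algebra_heisenberg _ _ _ _
        antipode_inverse_A(1) antipode_inverse_B(1)]) (intro clin)+

text \<open>
  The commutation relation \<open>a b = \<Sum> \<phi>(a1, b1) b2 a2\<close> of the Heisenberg double.
\<close>

lemma prod_AB_eq: "prod_AB = conv C scaleC \<Phi> prod_BA"
  unfolding conv_def
proof (rule ext, rule tensor_linear_eqI[of prod_AB])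
  fix a b
  have "sweedler C (a \<otimes> b) (\<lambda>x y. \<Phi> x *\<^sub>C prod_BA y) =
    sweedler A a (\<lambda>a1 a2. sweedler B b (\<lambda>b1 b2. (\<phi> a1 b1 *\<^sub>C b2) \<otimes> a2))"
    by (subst sweedler_C_pure, (intro dlin)[1]) (simp add: \<Phi>_pure prod_BA_pure emb_B_emb_A pure_tensor_scaleC)
  also have "\<dots> = sweedler A a (\<lambda>a1 a2. pair_act_B a1 b \<otimes> a2)"
    unfolding pair_act_B_def
    by (rule sweedler_cong, rule sweedler_pull[symmetric, of "\<lambda>t. t \<otimes> z" for z]) (intro dlin)+
  finally show "prod_AB (a \<otimes> b) = sweedler C (a \<otimes> b) (\<lambda>x y. \<Phi> x *\<^sub>C prod_BA y)"
    by (simp add: prod_AB_pure emb_A_emb_B)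
qed (intro dlin)+

lemma prod_BA_eq: "prod_BA = conv C scaleC \<Psi> prod_AB"
  unfolding prod_AB_eq by (simp add: conv_scaleC_cancel clinear_prods)

text \<open>
  Inverting the commutation relation \<open>prod_AB = \<Phi> * prod_BA\<close> in the convolution algebra reverses
  the order of the factors. So \<open>S a \<cdot> S b = \<Sum> \<phi>(a2, b2) (S b1 \<cdot> S a1)\<close> holds without computing how
  the antipodes interact with comultiplication.
\<close>

lemma antipode_AB_eq: "antipode_AB = conv C (\<lambda>x r. r *\<^sub>C x) antipode_BA \<Phi>"
proof -
  let ?m = "conv C (mult H)"
  have "antipode_AB = ?m (?m antipode_BA prod_AB) antipode_AB"
    unfolding antipode_BA_prod_AB
    by (rule ext) (simp add: conv_counit_left[OF coalg_C clinear_prods(4) H_bil] H_simps)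
  also have "\<dots> = ?m antipode_BA (?m prod_AB antipode_AB)"
    by (rule conv_assoc[OF coalg_C H_bil H_bil H_bil H_bil]; (intro dlin)?) (simp add: H_simps)
  also have "?m prod_AB antipode_AB = conv C scaleC \<Phi> (?m prod_BA antipode_AB)"
    unfolding prod_AB_eq
    by (rule conv_assoc[OF coalg_C H_bil cbilinear_scaleC cbilinear_scaleC H_bil]; (intro dlin)?)
      (simp add: H_simps)
  also have "\<dots> = (\<lambda>c. \<Phi> c *\<^sub>C \<one>\<^bsub>H\<^esub>)"
    unfolding prod_BA_antipode_AB
    by (rule ext) (simp add: conv_counit_right[OF coalg_C clinear_\<Phi> cbilinear_scaleC])
  also have "?m antipode_BA \<dots> = conv C (\<lambda>x r. r *\<^sub>C x) antipode_BA \<Phi>"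
    by (simp add: conv_def H_simps fun_eq_iff)
  finally show ?thesis .
qed

section \<open>The quantum double as a subalgebra of the enveloping algebra\<close>

abbreviation "D \<equiv> quantum_double A B \<phi>"
abbreviation "T \<equiv> enveloping H"

lemma sweedler_D: "sweedler D = sweedler C"
  by (simp add: sweedler_def fun_eq_iff quantum_double_def tensor_bialgebra_def)

lemma comult_D: "comult D = comult C" and counit_D: "counit D = counit C"
  by (simp_all add: quantum_double_def tensor_bialgebra_def)

lemma coalgebra_D: "coalgebra D"
  using coalg_C by (simp add: coalgebra_def sweedler_D comult_D counit_D)

lemma one_D: "\<one>\<^bsub>D\<^esub> = \<one>\<^bsub>A\<^esub> \<otimes> \<one>\<^bsub>B\<^esub>"
  by (simp add: quantum_double_def)

text \<open>
  The product \<open>(1 \<otimes> b) (a \<otimes> 1)\<close> of the quantum double as a function of \<open>a \<otimes> b\<close>: it is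
  \<open>\<Sum> \<Psi>(c1) \<Phi>(c3) c2\<close>, the conjugation of the identity by the pairing.
\<close>

definition "exchange = conv C (\<lambda>x r. r *\<^sub>C x) (conv C scaleC \<Psi> (\<lambda>c. c)) \<Phi>"

lemma clinear_exchange: "clinear exchange"
  unfolding exchange_def
  by (intro clinear_conv coalg_C dlin)

lemma exchange_pull:
  assumes "clinear G"
  shows "G (exchange c) = conv C (\<lambda>x r. r *\<^sub>C x) (conv C scaleC \<Psi> G) \<Phi> c"
proof -
  have "clinear (conv C scaleC \<Psi> (\<lambda>c. c))"
    by (intro clinear_conv coalg_C dlin)
  then show ?thesis
    unfolding exchange_def
    by (simp add: conv_scaleC_pull[OF assms] clinear_\<Phi> clinear_\<Psi> clinear_ident)
qed

definition "sandwich a b d = tensor_lift (\<lambda>x y. (a \<cdot>\<^bsub>A\<^esub> x) \<otimes> (y \<cdot>\<^bsub>B\<^esub> b)) d"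

lemma sandwich_pure: "sandwich a b (x \<otimes> y) = (a \<cdot>\<^bsub>A\<^esub> x) \<otimes> (y \<cdot>\<^bsub>B\<^esub> b)"
  unfolding sandwich_def by (rule tensor_lift_pure) (intro plin)

lemma clinear_sandwich [THEN clinear_compose]:
  "clinear (sandwich a b)" "clinear (\<lambda>a. sandwich a b d)" "clinear (\<lambda>b. sandwich a b d)"
  unfolding sandwich_def by (intro plin)+

lemmas xlin' = dlin clinear_sandwich clinear_exchange clinear_exchange[THEN clinear_compose]

lemma exchange_pure:
  "exchange (a \<otimes> b) = sweedler A a (\<lambda>a1 u. sweedler A u (\<lambda>a2 a3. sweedler B b (\<lambda>b1 v. sweedler B v (\<lambda>b2 b3.
      (\<phi> (inv (antipode A) a1) b1 * \<phi> a3 b3) *\<^sub>C (a2 \<otimes> b2)))))"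
proof -
  have "exchange (a \<otimes> b) = sweedler C (a \<otimes> b) (\<lambda>u t. sweedler C u (\<lambda>r s. (\<Psi> r * \<Phi> t) *\<^sub>C s))"
    unfolding exchange_def conv_def
    by (rule sweedler_cong, subst sweedler_pull[of "\<lambda>t. r *\<^sub>C t" for r]; (intro dlin)?)
      (simp add: scaleC_scaleC mult.commute)
  also have "\<dots> = sweedler C (a \<otimes> b) (\<lambda>r u. sweedler C u (\<lambda>s t. (\<Psi> r * \<Phi> t) *\<^sub>C s))"
    by (rule sweedler_tensor_assoc(2)[OF coalg_A coalg_B]) (intro dlin)+
  also have "\<dots> = sweedler A a (\<lambda>a1 u. sweedler A u (\<lambda>a2 a3. sweedler B b (\<lambda>b1 v. sweedler B v (\<lambda>b2 b3.
      (\<Psi> (a1 \<otimes> b1) * \<Phi> (a3 \<otimes> b3)) *\<^sub>C (a2 \<otimes> b2)))))"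
    by (rule sweedler_tensor_assoc(1)[OF coalg_A coalg_B]) (intro dlin)+
  finally show ?thesis
    by (simp add: \<Phi>_pure \<Psi>_pure)
qed

lemma sandwich_exchange:
  "sandwich a b' (exchange (a' \<otimes> b)) = sweedler3 A a' (\<lambda>a1 a2 a3. sweedler3 B b (\<lambda>b1 b2 b3.
    (\<phi> (inv (antipode A) a1) b1 * \<phi> a3 b3) *\<^sub>C ((a \<cdot>\<^bsub>A\<^esub> a2) \<otimes> (b2 \<cdot>\<^bsub>B\<^esub> b'))))"
  unfolding exchange_pure sweedler3_def
  by (subst sweedler_pull[of "sandwich a b'"], (intro xlin')[1], (intro xlin')[1])+
    (simp add: clinear_scale[OF clinear_sandwich(1)[OF clinear_ident]] sandwich_pure)

lemma double_mult_pure: "(a \<otimes> b) \<cdot>\<^bsub>D\<^esub> (a' \<otimes> b') = sandwich a b' (exchange (a' \<otimes> b))"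
  and cbilinear_double_mult: "cbilinear (mult D)"
  unfolding quantum_double_def alg.simps sandwich_exchange[symmetric]
  by (rule tensor_lift_tensor_lift(2); intro xlin') (rule tensor_lift_tensor_lift(1); intro xlin')

lemmas xlin = xlin' cbilinear_left[OF cbilinear_double_mult] cbilinear_right[OF cbilinear_double_mult]

text \<open>
  The element \<open>\<Sum> (a1 b1) \<otimes> (S b2 \<cdot> S a2)\<close> of the enveloping algebra of the Heisenberg double. It
  acts by the adjoint action of \<open>b\<close> followed by that of \<open>a\<close>.
\<close>

definition "env_embed = conv C pure_tensor prod_AB antipode_BA"

abbreviation "adjoint_A \<equiv> env_adjoint A emb_A"
abbreviation "adjoint_B \<equiv> env_adjoint B emb_B"

lemmas T_mult = env_adjoint_mult[OF algebra_heisenberg hopf_A clinear_emb(1) emb_A_mult emb_one(1)]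
    env_adjoint_mult[OF algebra_heisenberg hopf_B clinear_emb(2) emb_B_mult emb_one(2)]
lemmas T_one = env_adjoint_one[OF algebra_heisenberg hopf_A clinear_emb(1) emb_A_mult emb_one(1)]
    env_adjoint_one[OF algebra_heisenberg hopf_B clinear_emb(2) emb_B_mult emb_one(2)]
lemmas T_alg = algebraD[OF algebra_enveloping[OF algebra_heisenberg]]

lemma clinear_embed: "clinear env_embed"
  unfolding env_embed_def by (intro clinear_conv coalg_C cbilinear_pure_tensor dlin)

lemmas tlin = xlin clinear_embed clinear_embed[THEN clinear_compose]
  mult_linear[OF algebra_enveloping[OF algebra_heisenberg]]

lemma env_embed_pure: "env_embed (a \<otimes> b) = adjoint_A a \<cdot>\<^bsub>T\<^esub> adjoint_B b"
proof -
  have "env_embed (a \<otimes> b) = sweedler A a (\<lambda>a1 a2. sweedler B b (\<lambda>b1 b2.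
      (emb_A a1 \<otimes> emb_A (antipode A a2)) \<cdot>\<^bsub>T\<^esub> (emb_B b1 \<otimes> emb_B (antipode B b2))))"
    unfolding env_embed_def conv_def
    by (subst sweedler_C_pure, (intro tlin)[1])
      (simp add: prod_AB_pure antipode_BA_pure enveloping_mult_pure[OF algebra_heisenberg])
  also have "\<dots> = sweedler A a (\<lambda>a1 a2. (emb_A a1 \<otimes> emb_A (antipode A a2)) \<cdot>\<^bsub>T\<^esub> adjoint_B b)"
    unfolding env_adjoint_def
    by (rule sweedler_cong, rule sweedler_pull[symmetric, of "\<lambda>t. s \<cdot>\<^bsub>T\<^esub> t" for s]) (intro tlin)+
  also have "\<dots> = adjoint_A a \<cdot>\<^bsub>T\<^esub> adjoint_B b"
    unfolding env_adjoint_def[of A]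
    by (rule sweedler_pull[symmetric, of "\<lambda>t. t \<cdot>\<^bsub>T\<^esub> s" for s]) (intro tlin)+
  finally show ?thesis .
qed

lemma env_embed_sandwich: "env_embed (sandwich a b d) = adjoint_A a \<cdot>\<^bsub>T\<^esub> env_embed d \<cdot>\<^bsub>T\<^esub> adjoint_B b"
  by (rule tensor_linear_eqI[of _ _ d], (intro tlin)[1], (intro tlin)[1])
    (simp add: sandwich_pure env_embed_pure T_mult T_alg)

text \<open>
  This is the heart of the matter. On the right the factors occur in the order
  \<open>(b1 a1) \<otimes> (S a2 \<cdot> S b2)\<close>. Reordering the first component costs a factor \<open>\<Psi>\<close> at the left end,
  reordering the second a factor \<open>\<Phi>\<close> at the right end, and these are the two pairings in the
  multiplication of the quantum double.
\<close>

lemma env_embed_exchange: "env_embed (exchange (a \<otimes> b)) = adjoint_B b \<cdot>\<^bsub>T\<^esub> adjoint_A a"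
proof -
  have "adjoint_B b \<cdot>\<^bsub>T\<^esub> adjoint_A a = sweedler B b (\<lambda>b1 b2.
      (emb_B b1 \<otimes> emb_B (antipode B b2)) \<cdot>\<^bsub>T\<^esub> adjoint_A a)"
    unfolding env_adjoint_def[of B]
    by (rule sweedler_pull[of "\<lambda>t. t \<cdot>\<^bsub>T\<^esub> s" for s]) (intro tlin)+
  also have "\<dots> = sweedler B b (\<lambda>b1 b2. sweedler A a (\<lambda>a1 a2.
      (emb_B b1 \<otimes> emb_B (antipode B b2)) \<cdot>\<^bsub>T\<^esub> (emb_A a1 \<otimes> emb_A (antipode A a2))))"
    unfolding env_adjoint_def
    by (rule sweedler_cong, rule sweedler_pull[of "\<lambda>t. s \<cdot>\<^bsub>T\<^esub> t" for s]) (intro tlin)+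
  also have "\<dots> = sweedler A a (\<lambda>a1 a2. sweedler B b (\<lambda>b1 b2.
      (emb_B b1 \<otimes> emb_B (antipode B b2)) \<cdot>\<^bsub>T\<^esub> (emb_A a1 \<otimes> emb_A (antipode A a2))))"
    by (rule sweedler_commute) (intro tlin)+
  also have "\<dots> = conv C pure_tensor prod_BA antipode_AB (a \<otimes> b)"
    unfolding conv_def
    by (subst sweedler_C_pure, (intro tlin)[1])
      (simp add: prod_BA_pure antipode_AB_pure enveloping_mult_pure[OF algebra_heisenberg])
  also have "\<dots> = conv C (\<lambda>x r. r *\<^sub>C x) (conv C scaleC \<Psi> env_embed) \<Phi> (a \<otimes> b)"
    unfolding prod_BA_eq antipode_AB_eq env_embed_def
    by (subst conv_conjugate[OF cbilinear_pure_tensor]) (intro clinear_prods refl)+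
  also have "\<dots> = env_embed (exchange (a \<otimes> b))"
    by (rule exchange_pull[symmetric, OF clinear_embed])
  finally show ?thesis by simp
qed

lemma env_embed_mult: "env_embed (s \<cdot>\<^bsub>D\<^esub> t) = env_embed s \<cdot>\<^bsub>T\<^esub> env_embed t"
proof (rule tensor_bilinear_eqI[of "\<lambda>s t. env_embed (s \<cdot>\<^bsub>D\<^esub> t)" "\<lambda>s t. env_embed s \<cdot>\<^bsub>T\<^esub> env_embed t"])
  show "cbilinear (\<lambda>s t. env_embed (s \<cdot>\<^bsub>D\<^esub> t))" "cbilinear (\<lambda>s t. env_embed s \<cdot>\<^bsub>T\<^esub> env_embed t)"
    by (intro tlin)+
  show "env_embed ((x \<otimes> y) \<cdot>\<^bsub>D\<^esub> (u \<otimes> v)) = env_embed (x \<otimes> y) \<cdot>\<^bsub>T\<^esub> env_embed (u \<otimes> v)" for x y u v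
    by (simp add: double_mult_pure env_embed_sandwich env_embed_exchange env_embed_pure T_alg)
qed

lemma env_embed_one: "env_embed \<one>\<^bsub>D\<^esub> = \<one>\<^bsub>T\<^esub>"
  by (simp add: one_D env_embed_pure T_one T_alg)

text \<open>
  Applying the counits to the second component, where \<open>b \<sharp> a\<close> is sent to \<open>\<epsilon>(b) \<epsilon>(a)\<close>, recovers
  \<open>prod_AB\<close>. This is \<open>\<Phi> * prod_BA\<close>, where \<open>prod_BA\<close> is the flip \<open>A \<otimes> B \<rightarrow> B \<otimes> A\<close> and convolution with
  \<open>\<Phi>\<close> is undone by convolution with \<open>\<Psi>\<close>.
\<close>

lemma inj_env_embed: "env_embed s = env_embed t \<Longrightarrow> s = t"
proof -
  \<comment> \<open>\<open>?\<kappa>\<close> applies the counits to the second component, \<open>?\<tau>\<close> is the flip, \<open>?\<nu>\<close> cancels \<open>\<Phi>\<close>.\<close>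
  let ?\<eta> = "tensor_lift (\<lambda>y x. counit B y * counit A x) :: 'b \<otimes> 'a \<Rightarrow> complex"
  let ?\<kappa> = "tensor_lift (\<lambda>p q. ?\<eta> q *\<^sub>C p)"
  let ?\<tau> = "tensor_lift (\<lambda>y x. x \<otimes> y)"
  let ?\<nu> = "conv C scaleC \<Psi> (\<lambda>c. c)"
  have \<eta>_pure: "?\<eta> (y \<otimes> x) = counit B y * counit A x" for x y
    by (rule tensor_lift_pure) (intro plin)
  have \<eta>: "clinear ?\<eta>"
    by (rule clinear_tensor_lift) (intro plin)
  have \<kappa>_pure: "?\<kappa> (p \<otimes> q) = ?\<eta> q *\<^sub>C p" for p q
    by (rule tensor_lift_pure) (intro plin \<eta>[THEN clinear_compose])
  have \<kappa>: "clinear ?\<kappa>"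
    by (rule clinear_tensor_lift) (intro plin \<eta>[THEN clinear_compose])
  have \<tau>_pure: "?\<tau> (y \<otimes> x) = x \<otimes> y" for x :: 'a and y :: 'b
    by (rule tensor_lift_pure) (intro plin)
  have \<tau>: "clinear (?\<tau> :: 'b \<otimes> 'a \<Rightarrow> 'a \<otimes> 'b)"
    by (rule clinear_tensor_lift) (intro plin)
  have \<nu>: "clinear ?\<nu>"
    by (intro clinear_conv coalg_C dlin)
  have "?\<eta> (antipode_BA c) = counit C c" for c
  proof (rule tensor_linear_eqI[of _ _ c])
    show "?\<eta> (antipode_BA (a \<otimes> b)) = counit C (a \<otimes> b)" for a b
      by (simp add: antipode_BA_pure emb_B_emb_A \<eta>_pure counit_C_pure
          counit_antipode[OF hopf_A] counit_antipode[OF hopf_B])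
  qed (intro dlin \<eta>[THEN clinear_compose])+
  then have "?\<kappa> (env_embed c) = conv C (\<lambda>x r. r *\<^sub>C x) prod_AB (counit C) c" for c
    unfolding env_embed_def
    by (subst conv_pull[OF \<kappa> cbilinear_pure_tensor clinear_prods(1,3)]) (simp add: conv_def \<kappa>_pure)
  then have \<kappa>_embed: "?\<kappa> (env_embed c) = prod_AB c" for c
    by (simp add: conv_counit_scaleC(2)[OF coalg_C clinear_prods(1)])
  have "?\<tau> (prod_BA c) = c" for c
    by (rule tensor_linear_eqI[of _ _ c])
      (((intro dlin \<tau>[THEN clinear_compose])[1])+, simp add: prod_BA_pure emb_B_emb_A \<tau>_pure)
  then have "?\<tau> (prod_AB c) = conv C scaleC \<Phi> (\<lambda>c. c) c" for c
    unfolding prod_AB_eq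
    by (simp add: conv_scaleC_pull(1)[OF \<tau> clinear_\<Phi> clinear_prods(2)])
  then have "?\<nu> (?\<tau> (prod_AB c)) = conv C scaleC \<Phi> (conv C scaleC \<Psi> (\<lambda>c. c)) c" for c
    by (simp add: conv_scaleC_pull(1)[OF \<nu> clinear_\<Phi> clinear_ident])
  then have inverse: "?\<nu> (?\<tau> (?\<kappa> (env_embed c))) = c" for c
    by (simp add: \<kappa>_embed conv_scaleC_cancel(1)[OF clinear_ident])
  assume eq: "env_embed s = env_embed t"
  have "s = ?\<nu> (?\<tau> (?\<kappa> (env_embed s)))"
    by (rule inverse[symmetric])
  also have "\<dots> = t"
    unfolding eq by (rule inverse)
  finally show "s = t" .
qed

text \<open>
  The associative and unit laws are inherited from the enveloping algebra.
\<close>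

lemma algebra_D: "algebra D"
proof -
  have "(s \<cdot>\<^bsub>D\<^esub> t) \<cdot>\<^bsub>D\<^esub> r = s \<cdot>\<^bsub>D\<^esub> (t \<cdot>\<^bsub>D\<^esub> r)" for s t r
    by (rule inj_env_embed) (simp add: env_embed_mult T_alg)
  moreover have "\<one>\<^bsub>D\<^esub> \<cdot>\<^bsub>D\<^esub> s = s" "s \<cdot>\<^bsub>D\<^esub> \<one>\<^bsub>D\<^esub> = s" for s
    by (rule inj_env_embed, simp add: env_embed_mult env_embed_one T_alg)+
  ultimately show ?thesis
    using cbilinear_double_mult by (simp add: algebra_def)
qed

section \<open>The quantum double is a bialgebra\<close>

text \<open>
  This says that \<open>exchange\<close> is a morphism of coalgebras: in
  \<open>\<Sum> \<Psi>(c1) c2 \<Phi>(c3) \<otimes> \<Psi>(c4) c5 \<Phi>(c6)\<close> the two inner scalar factors cancel.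
\<close>

lemma sweedler_exchange:
  assumes F: "cbilinear F"
  shows "sweedler C (exchange c) F = sweedler C c (\<lambda>r s. F (exchange r) (exchange s))"
proof -
  have bil: "cbilinear (\<lambda>x r. r *\<^sub>C (x :: 'a \<otimes> 'b))"
    by (intro lin)
  have F_scale: "F (r *\<^sub>C x) y = r *\<^sub>C F x y" "F x (r *\<^sub>C y) = r *\<^sub>C F x y" for r x y
    by (rule cbilinear_scale[OF F])+
  let ?l = "conv C scaleC \<Psi> (\<lambda>c. c)" and ?r = "conv C (\<lambda>x r. r *\<^sub>C x) (\<lambda>c. c) \<Phi>"
  have l: "clinear ?l" and r: "clinear ?r"
    by (intro clinear_conv coalg_C dlin)+
  have ex: "exchange = conv C scaleC \<Psi> ?r"
    unfolding exchange_def
    by (rule conv_assoc[OF coalg_C bil cbilinear_scaleC cbilinear_scaleC bil]; (intro dlin)?)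
      (simp add: scaleC_scaleC mult.commute)
  have "conv C F exchange exchange = conv C F (conv C (\<lambda>x r. r *\<^sub>C x) ?l \<Phi>) (conv C scaleC \<Psi> ?r)"
    by (simp add: ex[symmetric]) (simp add: exchange_def)
  also have "\<dots> = conv C F ?l (conv C scaleC \<Phi> (conv C scaleC \<Psi> ?r))"
    by (rule conv_assoc[OF coalg_C F bil F cbilinear_scaleC]; (intro l dlin clinear_conv[OF coalg_C] cbilinear_scaleC bil)?)
      (simp add: F_scale)
  also have "\<dots> = conv C F ?l ?r"
    by (simp add: conv_scaleC_cancel r)
  also have "\<dots> = conv C (\<lambda>x r. r *\<^sub>C x) (conv C scaleC \<Psi> (conv C F (\<lambda>c. c) (\<lambda>c. c))) \<Phi>"
    by (rule conv_conjugate[OF F clinear_ident clinear_ident])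
  also have "\<dots> = (\<lambda>c. conv C F (\<lambda>c. c) (\<lambda>c. c) (exchange c))"
    by (rule ext, rule exchange_pull[symmetric]) (intro clinear_conv coalg_C F clinear_ident)
  finally have "conv C F exchange exchange c = conv C F (\<lambda>c. c) (\<lambda>c. c) (exchange c)"
    by simp
  then show ?thesis
    by (simp add: conv_def)
qed

lemma sweedler_sandwich:
  assumes F: "cbilinear F"
  shows "sweedler C (sandwich a b d) F = sweedler A a (\<lambda>a1 a2. sweedler B b (\<lambda>b1 b2.
    sweedler C d (\<lambda>r s. F (sandwich a1 b1 r) (sandwich a2 b2 s))))"
proof (rule tensor_linear_eqI[of _ _ d])
  note lin' = xlin cbilinear_left[OF F] cbilinear_right[OF F]
  show "clinear (\<lambda>d. sweedler C (sandwich a b d) F)"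
    "clinear (\<lambda>d. sweedler A a (\<lambda>a1 a2. sweedler B b (\<lambda>b1 b2.
      sweedler C d (\<lambda>r s. F (sandwich a1 b1 r) (sandwich a2 b2 s)))))"
    by (intro lin')+
  fix x y
  let ?G = "\<lambda>a1 a2 x1 x2 b1 b2 y1 y2. F ((a1 \<cdot>\<^bsub>A\<^esub> x1) \<otimes> (y1 \<cdot>\<^bsub>B\<^esub> b1)) ((a2 \<cdot>\<^bsub>A\<^esub> x2) \<otimes> (y2 \<cdot>\<^bsub>B\<^esub> b2))"
  have "sweedler C (sandwich a b (x \<otimes> y)) F = sweedler A a (\<lambda>a1 a2. sweedler A x (\<lambda>x1 x2.
      sweedler B y (\<lambda>y1 y2. sweedler B b (\<lambda>b1 b2. ?G a1 a2 x1 x2 b1 b2 y1 y2))))"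
    unfolding sandwich_pure
    by (subst sweedler_C_pure sweedler_mult[OF bialg_A] sweedler_mult[OF bialg_B], (intro F lin')[1])+ (rule refl)
  also have "\<dots> = sweedler A a (\<lambda>a1 a2. sweedler A x (\<lambda>x1 x2.
      sweedler B b (\<lambda>b1 b2. sweedler B y (\<lambda>y1 y2. ?G a1 a2 x1 x2 b1 b2 y1 y2))))"
    by (intro sweedler_cong, rule sweedler_commute) (intro lin')+
  also have "\<dots> = sweedler A a (\<lambda>a1 a2. sweedler B b (\<lambda>b1 b2.
      sweedler A x (\<lambda>x1 x2. sweedler B y (\<lambda>y1 y2. ?G a1 a2 x1 x2 b1 b2 y1 y2))))"
    by (rule sweedler_cong, rule sweedler_commute) (intro lin')+
  also have "\<dots> = sweedler A a (\<lambda>a1 a2. sweedler B b (\<lambda>b1 b2.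
    sweedler C (x \<otimes> y) (\<lambda>r s. F (sandwich a1 b1 r) (sandwich a2 b2 s))))"
    by (intro sweedler_cong, subst sweedler_C_pure, (intro lin')[1]) (simp add: sandwich_pure)
  finally show "sweedler C (sandwich a b (x \<otimes> y)) F = \<dots>" .
qed

text \<open>
  The outer factors \<open>a\<close> and \<open>b'\<close> are compatible with comultiplication because \<open>A\<close> and \<open>B\<close> are
  bialgebras, the inner ones by \<open>sweedler_exchange\<close>. What remains is to reorder independent sums.
\<close>

lemma sweedler_double_mult_pure:
  "comult C ((a \<otimes> b) \<cdot>\<^bsub>D\<^esub> (a' \<otimes> b')) = sweedler C (a \<otimes> b) (\<lambda>s1 s2.
    sweedler C (a' \<otimes> b') (\<lambda>t1 t2. (s1 \<cdot>\<^bsub>D\<^esub> t1) \<otimes> (s2 \<cdot>\<^bsub>D\<^esub> t2)))"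
proof -
  let ?G = "\<lambda>a1 a2 b1 b2 a1' a2' b1' b2'.
    ((a1 \<otimes> b1) \<cdot>\<^bsub>D\<^esub> (a1' \<otimes> b1')) \<otimes> ((a2 \<otimes> b2) \<cdot>\<^bsub>D\<^esub> (a2' \<otimes> b2'))"
  have "comult C ((a \<otimes> b) \<cdot>\<^bsub>D\<^esub> (a' \<otimes> b')) = sweedler A a (\<lambda>a1 a2. sweedler B b' (\<lambda>b1' b2'.
    sweedler C (exchange (a' \<otimes> b)) (\<lambda>r s. sandwich a1 b1' r \<otimes> sandwich a2 b2' s)))"
    unfolding sweedler_pure_tensor[symmetric] double_mult_pure
    by (rule sweedler_sandwich[OF cbilinear_pure_tensor])
  also have "\<dots> = sweedler A a (\<lambda>a1 a2. sweedler B b' (\<lambda>b1' b2'.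
    sweedler C (a' \<otimes> b) (\<lambda>r s. sandwich a1 b1' (exchange r) \<otimes> sandwich a2 b2' (exchange s))))"
    by (intro sweedler_cong sweedler_exchange) (intro xlin)
  also have "\<dots> = sweedler A a (\<lambda>a1 a2. sweedler B b' (\<lambda>b1' b2'.
    sweedler A a' (\<lambda>a1' a2'. sweedler B b (\<lambda>b1 b2. ?G a1 a2 b1 b2 a1' a2' b1' b2'))))"
    by (intro sweedler_cong, subst sweedler_C_pure, (intro xlin)[1]) (simp add: double_mult_pure)
  also have "\<dots> = sweedler A a (\<lambda>a1 a2. sweedler B b' (\<lambda>b1' b2'.
    sweedler B b (\<lambda>b1 b2. sweedler A a' (\<lambda>a1' a2'. ?G a1 a2 b1 b2 a1' a2' b1' b2'))))"
    by (intro sweedler_cong, rule sweedler_commute) (intro xlin)+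
  also have "\<dots> = sweedler A a (\<lambda>a1 a2. sweedler B b (\<lambda>b1 b2. sweedler B b' (\<lambda>b1' b2'.
    sweedler A a' (\<lambda>a1' a2'. ?G a1 a2 b1 b2 a1' a2' b1' b2'))))"
    by (rule sweedler_cong, rule sweedler_commute) (intro xlin)+
  also have "\<dots> = sweedler A a (\<lambda>a1 a2. sweedler B b (\<lambda>b1 b2. sweedler A a' (\<lambda>a1' a2'.
    sweedler B b' (\<lambda>b1' b2'. ?G a1 a2 b1 b2 a1' a2' b1' b2'))))"
    by (intro sweedler_cong, rule sweedler_commute) (intro xlin)+
  also have "\<dots> = sweedler A a (\<lambda>a1 a2. sweedler B b (\<lambda>b1 b2. sweedler C (a' \<otimes> b') (\<lambda>t1 t2.
    ((a1 \<otimes> b1) \<cdot>\<^bsub>D\<^esub> t1) \<otimes> ((a2 \<otimes> b2) \<cdot>\<^bsub>D\<^esub> t2))))"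
    by (intro sweedler_cong, rule sweedler_C_pure[symmetric]) (intro xlin)
  also have "\<dots> = sweedler C (a \<otimes> b) (\<lambda>s1 s2.
    sweedler C (a' \<otimes> b') (\<lambda>t1 t2. (s1 \<cdot>\<^bsub>D\<^esub> t1) \<otimes> (s2 \<cdot>\<^bsub>D\<^esub> t2)))"
    by (rule sweedler_C_pure[symmetric]) (intro xlin)
  finally show ?thesis .
qed

lemma counit_double_mult: "counit C (s \<cdot>\<^bsub>D\<^esub> t) = counit C s * counit C t"
proof (rule tensor_bilinear_eqI[of "\<lambda>s t. counit C (s \<cdot>\<^bsub>D\<^esub> t)" "\<lambda>s t. counit C s * counit C t"])
  show "cbilinear (\<lambda>s t. counit C (s \<cdot>\<^bsub>D\<^esub> t))" "cbilinear (\<lambda>s t. counit C s * counit C t)"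
    by (intro xlin)+
  have exchange: "counit C (exchange c) = counit C c" for c
  proof -
    have "conv C scaleC \<Psi> (counit C) = \<Psi>"
      using conv_counit_scaleC(2)[OF coalg_C clinear_\<Psi>]
      by (simp add: conv_def scaleC_complex_def mult.commute fun_eq_iff)
    then have "counit C (exchange c) = conv C scaleC \<Psi> \<Phi> c"
      using exchange_pull[OF coalgebra_linear(2)[OF coalg_C], of c]
      by (simp add: conv_def scaleC_complex_def mult.commute)
    then show ?thesis by (simp add: \<Psi>_\<Phi>)
  qed
  have sandwich: "counit C (sandwich a b d) = counit A a * counit C d * counit B b" for a b d
    by (rule tensor_linear_eqI[of _ _ d], (intro xlin)[1], (intro xlin)[1])
      (simp add: sandwich_pure counit_C_pure bialgebraD[OF bialg_A] bialgebraD[OF bialg_B])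
  show "counit C ((x \<otimes> y) \<cdot>\<^bsub>D\<^esub> (u \<otimes> v)) = counit C (x \<otimes> y) * counit C (u \<otimes> v)" for x y u v
    by (simp add: double_mult_pure exchange sandwich counit_C_pure)
qed

lemma bialgebra_D: "bialgebra D"
proof -
  have "comult C (s \<cdot>\<^bsub>D\<^esub> t) = sweedler C s (\<lambda>s1 s2.
    sweedler C t (\<lambda>t1 t2. (s1 \<cdot>\<^bsub>D\<^esub> t1) \<otimes> (s2 \<cdot>\<^bsub>D\<^esub> t2)))" for s t
  proof (rule tensor_bilinear_eqI[of "\<lambda>s t. comult C (s \<cdot>\<^bsub>D\<^esub> t)" "\<lambda>s t. sweedler C s (\<lambda>s1 s2.
      sweedler C t (\<lambda>t1 t2. (s1 \<cdot>\<^bsub>D\<^esub> t1) \<otimes> (s2 \<cdot>\<^bsub>D\<^esub> t2)))"])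
    show "cbilinear (\<lambda>s t. comult C (s \<cdot>\<^bsub>D\<^esub> t))"
      by (rule cbilinearI; rule clinear_compose[OF coalgebra_linear(1)[OF coalg_C]]) (intro xlin)+
    show "cbilinear (\<lambda>s t. sweedler C s (\<lambda>s1 s2.
      sweedler C t (\<lambda>t1 t2. (s1 \<cdot>\<^bsub>D\<^esub> t1) \<otimes> (s2 \<cdot>\<^bsub>D\<^esub> t2))))"
      by (intro xlin)
  qed (rule sweedler_double_mult_pure)
  moreover have "comult C (\<one>\<^bsub>A\<^esub> \<otimes> \<one>\<^bsub>B\<^esub>) = (\<one>\<^bsub>A\<^esub> \<otimes> \<one>\<^bsub>B\<^esub>) \<otimes> (\<one>\<^bsub>A\<^esub> \<otimes> \<one>\<^bsub>B\<^esub>)"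
    unfolding sweedler_pure_tensor[symmetric]
    by (subst sweedler_C_pure sweedler_one[OF bialg_A] sweedler_one[OF bialg_B], (intro xlin)[1])+ (rule refl)
  ultimately show ?thesis
    by (simp add: bialgebra_def algebra_D coalgebra_D sweedler_D comult_D counit_D
        counit_double_mult one_D counit_C_pure bialgebraD[OF bialg_A] bialgebraD[OF bialg_B])
qed

section \<open>The diagonal action is adjoint\<close>

definition "ad d u = env_act H (env_embed d) u"

lemma ad_pure: "ad (a \<otimes> b) u = env_act H (adjoint_A a) (env_act H (adjoint_B b) u)"
  by (simp add: ad_def env_embed_pure env_act_mult[OF algebra_heisenberg])

lemma cbilinear_ad: "cbilinear ad"
  unfolding ad_def
  by (intro lin cbilinear_left[OF cbilinear_env_act[OF algebra_heisenberg]]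
      cbilinear_right[OF cbilinear_env_act[OF algebra_heisenberg]] clinear_embed)

lemma env_act_adjoint:
  "env_act H (adjoint_A a) u = sweedler A a (\<lambda>a1 a2. emb_A a1 \<cdot>\<^bsub>H\<^esub> u \<cdot>\<^bsub>H\<^esub> emb_A (antipode A a2))"
  "env_act H (adjoint_B b) u = sweedler B b (\<lambda>b1 b2. emb_B b1 \<cdot>\<^bsub>H\<^esub> u \<cdot>\<^bsub>H\<^esub> emb_B (antipode B b2))"
  unfolding env_adjoint_def
  by (subst sweedler_pull[of "\<lambda>t. env_act H t u"],
      rule cbilinear_left[OF cbilinear_env_act[OF algebra_heisenberg] clinear_ident],
      (intro elin)[1], simp add: env_act_pure[OF algebra_heisenberg])+

definition "adj_A a x = sweedler A a (\<lambda>a1 a2. a1 \<cdot>\<^bsub>A\<^esub> x \<cdot>\<^bsub>A\<^esub> antipode A a2)"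
definition "adj_B b y = sweedler B b (\<lambda>b1 b2. b1 \<cdot>\<^bsub>B\<^esub> y \<cdot>\<^bsub>B\<^esub> antipode B b2)"
definition "pair_act_A b x = sweedler A x (\<lambda>x1 x2. \<phi> x1 (antipode B b) *\<^sub>C x2)"

lemma cbilinear_actions: "cbilinear adj_A" "cbilinear adj_B" "cbilinear pair_act_A"
  unfolding adj_A_def adj_B_def pair_act_A_def by (intro plin)+

lemmas alin = tlin
  cbilinear_actions[THEN cbilinear_left] cbilinear_actions[THEN cbilinear_right]

lemma env_act_A_emb_A: "env_act H (adjoint_A a) (emb_A x) = emb_A (adj_A a x)"
  unfolding env_act_adjoint adj_A_def emb_A_mult[symmetric]
  by (rule sweedler_pull[symmetric]) (intro elin)+

lemma env_act_B_emb_B: "env_act H (adjoint_B b) (emb_B y) = emb_B (adj_B b y)"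
  unfolding env_act_adjoint adj_B_def emb_B_mult[symmetric]
  by (rule sweedler_pull[symmetric]) (intro elin)+

text \<open>
  In \<open>\<Sum> a1 \<cdot> y \<cdot> S a2\<close> the commutation relation moves \<open>a1\<close> past \<open>y\<close>, where its remaining component
  cancels against the antipode. The action through the pairing is thus an adjoint action inside
  the Heisenberg double.
\<close>

lemma env_act_A_emb_B: "env_act H (adjoint_A a) (emb_B y) = emb_B (pair_act_B a y)"
proof -
  have "env_act H (adjoint_A a) (emb_B y) =
    sweedler A a (\<lambda>u a3. sweedler A u (\<lambda>a1 a2. pair_act_B a1 y \<otimes> (a2 \<cdot>\<^bsub>A\<^esub> antipode A a3)))"
    unfolding env_act_adjoint emb_A_emb_B
    by (rule sweedler_cong, subst sweedler_pull[of "\<lambda>t. t \<cdot>\<^bsub>H\<^esub> s" for s]; (intro elin)?)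
      (simp add: emb_A_def heisenberg_mult_A)
  also have "\<dots> = sweedler A a (\<lambda>a1 u. sweedler A u (\<lambda>a2 a3. pair_act_B a1 y \<otimes> (a2 \<cdot>\<^bsub>A\<^esub> antipode A a3)))"
    by (rule sweedler_coassoc[OF coalg_A]) (intro elin)+
  also have "\<dots> = sweedler A a (\<lambda>a1 u. pair_act_B a1 y \<otimes> sweedler A u (\<lambda>a2 a3. a2 \<cdot>\<^bsub>A\<^esub> antipode A a3))"
    by (rule sweedler_cong, rule sweedler_pull[symmetric, of "\<lambda>t. s \<otimes> t" for s]) (intro elin)+
  also have "\<dots> = sweedler A a (\<lambda>a1 u. counit A u *\<^sub>C (pair_act_B a1 y \<otimes> \<one>\<^bsub>A\<^esub>))"
    by (simp add: hopf_algebraD[OF hopf_A] pure_tensor_scaleC)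
  also have "\<dots> = emb_B (pair_act_B a y)"
    unfolding emb_B_def by (rule sweedler_counit_right[OF coalg_A]) (intro elin)
  finally show ?thesis .
qed

text \<open>
  The same for the action of \<open>B\<close> on \<open>A\<close>, with the inverse commutation relation. It produces the
  inverse \<open>\<Psi>\<close> of the pairing, which by \<open>pairing_antipode\<close> is the pairing with the antipode of \<open>b\<close>
  that occurs in the Schroedinger representation.
\<close>

lemma env_act_B_emb_A: "env_act H (adjoint_B b) (emb_A x) = emb_A (pair_act_A b x)"
proof -
  have BA: "emb_B b \<cdot>\<^bsub>H\<^esub> emb_A x = sweedler A x (\<lambda>x1 x2. sweedler B b (\<lambda>b1 b2.
      \<Psi> (x1 \<otimes> b1) *\<^sub>C (emb_A x2 \<cdot>\<^bsub>H\<^esub> emb_B b2)))" for b x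
  proof -
    have "emb_B b \<cdot>\<^bsub>H\<^esub> emb_A x = conv C scaleC \<Psi> prod_AB (x \<otimes> b)"
      by (simp add: prod_BA_eq[symmetric] prod_BA_pure)
    then show ?thesis
      unfolding conv_def
      by (subst (asm) sweedler_C_pure, (intro dlin)[1]) (simp add: prod_AB_pure)
  qed
  have "env_act H (adjoint_B b) (emb_A x) = sweedler B b (\<lambda>u b3. sweedler A x (\<lambda>x1 x2.
      sweedler B u (\<lambda>b1 b2. \<Psi> (x1 \<otimes> b1) *\<^sub>C (emb_A x2 \<cdot>\<^bsub>H\<^esub> emb_B (b2 \<cdot>\<^bsub>B\<^esub> antipode B b3)))))"
    unfolding env_act_adjoint BA
    by (rule sweedler_cong, (subst sweedler_pull[of "\<lambda>t. t \<cdot>\<^bsub>H\<^esub> s" for s], (intro dlin)[1], (intro dlin)[1])+)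
      (simp add: emb_B_mult H_simps)
  also have "\<dots> = sweedler A x (\<lambda>x1 x2. sweedler B b (\<lambda>u b3.
      sweedler B u (\<lambda>b1 b2. \<Psi> (x1 \<otimes> b1) *\<^sub>C (emb_A x2 \<cdot>\<^bsub>H\<^esub> emb_B (b2 \<cdot>\<^bsub>B\<^esub> antipode B b3)))))"
    by (rule sweedler_commute) (intro dlin)+
  also have "\<dots> = sweedler A x (\<lambda>x1 x2. sweedler B b (\<lambda>b1 u.
      sweedler B u (\<lambda>b2 b3. \<Psi> (x1 \<otimes> b1) *\<^sub>C (emb_A x2 \<cdot>\<^bsub>H\<^esub> emb_B (b2 \<cdot>\<^bsub>B\<^esub> antipode B b3)))))"
    by (rule sweedler_cong, rule sweedler_coassoc[OF coalg_B]) (intro dlin)+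
  also have "\<dots> = sweedler A x (\<lambda>x1 x2. sweedler B b (\<lambda>b1 u. \<Psi> (x1 \<otimes> b1) *\<^sub>C (emb_A x2 \<cdot>\<^bsub>H\<^esub>
      emb_B (sweedler B u (\<lambda>b2 b3. b2 \<cdot>\<^bsub>B\<^esub> antipode B b3)))))"
    by (intro sweedler_cong, rule sweedler_pull[symmetric, of "\<lambda>t. r *\<^sub>C (s \<cdot>\<^bsub>H\<^esub> emb_B t)" for r s])
      (intro dlin)+
  also have "\<dots> = sweedler A x (\<lambda>x1 x2. sweedler B b (\<lambda>b1 u. counit B u *\<^sub>C (\<Psi> (x1 \<otimes> b1) *\<^sub>C emb_A x2)))"
    by (simp add: hopf_algebraD[OF hopf_B] clinear_scale[OF clinear_emb(2)] H_simps emb_one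
        scaleC_scaleC mult.commute)
  also have "\<dots> = sweedler A x (\<lambda>x1 x2. \<Psi> (x1 \<otimes> b) *\<^sub>C emb_A x2)"
    by (rule sweedler_cong, rule sweedler_counit_right[OF coalg_B]) (intro dlin)
  also have "\<dots> = sweedler A x (\<lambda>x1 x2. emb_A (\<phi> x1 (antipode B b) *\<^sub>C x2))"
    by (simp add: \<Psi>_pure pairing_antipode clinear_scale[OF clinear_emb(1)])
  also have "\<dots> = emb_A (pair_act_A b x)"
    unfolding pair_act_A_def by (rule sweedler_pull[symmetric]) (intro dlin)+
  finally show ?thesis .
qed

lemma schrodinger_A_eq: "schrodinger_A A B \<phi> d x = tensor_lift (\<lambda>a b. adj_A a (pair_act_A b x)) d"
  by (simp add: schrodinger_A_def adj_A_def pair_act_A_def)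

lemma schrodinger_B_eq: "schrodinger_B A B \<phi> d y = tensor_lift (\<lambda>a b. pair_act_B a (adj_B b y)) d"
  by (simp add: schrodinger_B_def adj_B_def pair_act_B_def)

lemma cbilinear_schrodinger: "cbilinear (schrodinger_A A B \<phi>)" "cbilinear (schrodinger_B A B \<phi>)"
  unfolding schrodinger_A_eq schrodinger_B_eq by (intro alin)+

lemmas slin = alin
  cbilinear_schrodinger[THEN cbilinear_left] cbilinear_schrodinger[THEN cbilinear_right]
  cbilinear_ad[THEN cbilinear_left] cbilinear_ad[THEN cbilinear_right]

lemma ad_emb_A: "ad d (emb_A x) = emb_A (schrodinger_A A B \<phi> d x)"
proof (rule tensor_linear_eqI[of _ _ d])
  fix a b
  have "schrodinger_A A B \<phi> (a \<otimes> b) x = adj_A a (pair_act_A b x)"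
    unfolding schrodinger_A_eq by (rule tensor_lift_pure) (intro alin)
  then show "ad (a \<otimes> b) (emb_A x) = emb_A (schrodinger_A A B \<phi> (a \<otimes> b) x)"
    by (simp add: ad_pure env_act_B_emb_A env_act_A_emb_A)
qed (intro slin)+

lemma ad_emb_B: "ad d (emb_B y) = emb_B (schrodinger_B A B \<phi> d y)"
proof (rule tensor_linear_eqI[of _ _ d])
  fix a b
  have "schrodinger_B A B \<phi> (a \<otimes> b) y = pair_act_B a (adj_B b y)"
    unfolding schrodinger_B_eq by (rule tensor_lift_pure) (intro alin)
  then show "ad (a \<otimes> b) (emb_B y) = emb_B (schrodinger_B A B \<phi> (a \<otimes> b) y)"
    by (simp add: ad_pure env_act_B_emb_B env_act_A_emb_B)
qed (intro slin)+

lemma ad_mult: "ad d (u \<cdot>\<^bsub>H\<^esub> v) = sweedler C d (\<lambda>d1 d2. ad d1 u \<cdot>\<^bsub>H\<^esub> ad d2 v)"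
  unfolding ad_def env_embed_def
  by (rule adjoint_act_mult[OF algebra_heisenberg coalg_C clinear_prods(1,3) antipode_BA_prod_AB])

lemma ad_one: "ad d \<one>\<^bsub>H\<^esub> = counit C d *\<^sub>C \<one>\<^bsub>H\<^esub>"
  unfolding ad_def env_embed_def
  by (rule adjoint_act_one[OF algebra_heisenberg coalg_C clinear_prods(1,3) prod_AB_antipode_BA])

text \<open>
  Since \<open>y \<sharp> x\<close> is the product of the images of \<open>y\<close> and \<open>x\<close>, on each of which the adjoint action
  is a Schroedinger representation, this is multiplicativity of the adjoint action.
\<close>

lemma diagonal_action_eq_ad: "diagonal_action A B \<phi> d u = ad d u"
proof -
  let ?s = "\<lambda>a b y x. sweedler A a (\<lambda>a1 a2. sweedler B b (\<lambda>b1 b2.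
      schrodinger_B A B \<phi> (a1 \<otimes> b1) y \<otimes> schrodinger_A A B \<phi> (a2 \<otimes> b2) x))"
  show ?thesis
  proof (rule tensor_bilinear_eqI[of "diagonal_action A B \<phi>" ad, OF _ cbilinear_ad])
    show "cbilinear (diagonal_action A B \<phi>)"
      unfolding diagonal_action_def
      by (rule tensor_lift_tensor_lift(1)[of ?s]) (intro slin)+
    fix a b y x
    have "diagonal_action A B \<phi> (a \<otimes> b) (y \<otimes> x) = ?s a b y x"
      unfolding diagonal_action_def
      by (rule tensor_lift_tensor_lift(2)[of ?s]) (intro slin)+
    also have "\<dots> = sweedler C (a \<otimes> b) (\<lambda>r s. schrodinger_B A B \<phi> r y \<otimes> schrodinger_A A B \<phi> s x)"
      by (rule sweedler_C_pure[symmetric]) (intro slin)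
    also have "\<dots> = sweedler C (a \<otimes> b) (\<lambda>r s. ad r (emb_B y) \<cdot>\<^bsub>H\<^esub> ad s (emb_A x))"
      by (simp add: ad_emb_A ad_emb_B emb_B_emb_A)
    also have "\<dots> = ad (a \<otimes> b) (y \<otimes> x)"
      by (simp add: ad_mult[symmetric] emb_B_emb_A)
    finally show "diagonal_action A B \<phi> (a \<otimes> b) (y \<otimes> x) = ad (a \<otimes> b) (y \<otimes> x)" .
  qed
qed

lemma module_algebra_heisenberg: "module_algebra D H (diagonal_action A B \<phi>)"
proof -
  have "ad \<one>\<^bsub>D\<^esub> u = u" for u
    by (simp add: ad_def env_embed_one enveloping_one[OF algebra_heisenberg] env_act_pure[OF algebra_heisenberg] H_simps)
  moreover have "ad (s \<cdot>\<^bsub>D\<^esub> t) u = ad s (ad t u)" for s t u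
    by (simp add: ad_def env_embed_mult env_act_mult[OF algebra_heisenberg])
  moreover have "diagonal_action A B \<phi> = ad"
    by (simp add: fun_eq_iff diagonal_action_eq_ad)
  ultimately show ?thesis
    by (simp add: module_algebra_def bialgebra_D algebra_heisenberg cbilinear_ad
        sweedler_D counit_D ad_mult ad_one)
qed

end

theorem proposition3:
  fixes A :: "('a :: complex_vector) hopf"
    and B :: "('b :: complex_vector) hopf"
    and \<phi> :: "'a \<Rightarrow> 'b \<Rightarrow> complex"
  assumes "hopf_algebra A" and "bij (antipode A)"
    and "hopf_algebra B" and "bij (antipode B)"
    and "hopf_pairing A B \<phi>"
  shows "module_algebra (quantum_double A B \<phi>) (heisenberg_double A B \<phi>) (diagonal_action A B \<phi>)"
proof -
  interpret hopf_pair A B \<phi>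
    using assms by unfold_locales
  show ?thesis
    by (rule module_algebra_heisenberg)
qed

end
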